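(* Let $M$ be a $3$-dimensional manifold with an ideal triangulation $K=\bigcup_{\nu=1}^N T_\nu$. Assume that $M$ has no boundary coming from $2$-skeletons on the boundary of $K$. Let $(K,z)\in\mathrm{Sol}(K)$ be a very generic parabolic decoration and let $(K,z^* )$ be its dual. Then, in $\mathcal{P}(\mathbb{C})$, $$\beta(K,z)=\beta(K,z^* ).$$ Hence $(K,z)$ and $(K,z^* )$ have the same volume.
   Context: Flags. Let $V=\mathbb{C}^3$ with its standard basis. A flag of $\mathbb{P}(V)=\mathbb{CP}^2$ is a pair $([x],[f])\in\mathbb{P}(V)\times\mathbb{P}(V^* )$ with $f(x)=0$; $\mathrm{PGL}(3,\mathbb{C})$ acts by $A([x],[f])=([Ax],[f\circ A^{-1}])$, and configurations are orbits of ordered tuples of flags. A configuration $T=([x_i],[f_i])_{1\le i\le 4}$ is a generic tetrahedron of flags if $f_i(x_j)\ne0$ for $i\ne j$ and no three of the $[x_i]$ are collinear. It is very generic if in addition no three of the lines $\ker f_i$ are concurrent. The dual of a flag $([x],[f])$ is $([f],[x])$ (identifying $V^*$ with $V$ through the dual basis), and the dual $T^*$ of $T$ is obtained by dualizing its four flags. Coordinates. For $i\neq j$, with $k,l$ such that $(1,2,3,4)\mapsto(i,j,k,l)$ is even, $z_{ij}(T)=\frac{f_i(x_k)\det(x_i,x_j,x_l)}{f_i(x_l)\det(x_i,x_j,x_k)}\in\mathbb{C}\setminus\{0,1\}$. For distinct $i,j,k$, $z_{ijk}(T)=\frac{f_i(x_j)f_j(x_k)f_k(x_i)}{f_i(x_k)f_j(x_i)f_k(x_j)}$.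 Ideal triangulations. $K=\bigcup_{\nu=1}^N T_\nu$ is a finite union of oriented $3$-simplices with identifications of faces in pairs by orientation-reversing simplicial maps (a quasi-simplicial complex: identifications on the boundary of a single simplex are allowed). The compact oriented $3$-manifold $M$ with boundary is a retract of $|K|-|K^{(0)}|$; its boundary comes from the links of the vertices and from the $2$-faces on the boundary of $K$ (those not paired with another face). "No boundary coming from $2$-skeletons on the boundary of $K$" means that all $2$-faces of all the $T_\nu$ are glued in pairs. The vertices of each $T_\nu$ are ordered as $1,2,3,4$ compatibly with its orientation. Decorations. A generic decoration $(K,z)$ assigns flags to the vertices of each $3$-simplex $T_\nu$ so that the four flags at its vertices form a generic tetrahedron of flags (also denoted $T_\nu$); $z=(z_{ij}(T_\nu))$ denotes the resulting coordinates. It is parabolic if the following hold. - Face equations: if $T,T'$ share a face $(ijk)$, oriented as a boundary face of $T$, then $z_{ijk}(T)z_{ikj}(T')=1$. - Edge equations: for each edge $e$ of $|K|$, if $T_{\nu_1},\dots,T_{\nu_n}$ are the simplices (with multiplicity) containing an edge $ij$ that projects to $e$ (with a consistent orientation), then $z_{ij}(T_{\nu_1})\cdots z_{ij}(T_{\nu_n})=z_{ji}(T_{\nu_1})\cdots z_{ji}(T_{\nu_n})=1$. $\mathrm{Sol}(K)$ is the set of generic parabolic decorations. A parabolic decoration is very generic if each $T_\nu$ is a very generic tetrahedron of flags. Its dual $(K,z^* )$ is obtained by replacing each tetrahedron of flags $T_\nu$ by its dual $T_\nu^*$. Invariants. $\mathcal{P}(\mathbb{C})$ is the quotient of $\mathbb{Z}[\mathbb{C}\setminus\{0,1\}]$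 by the subgroup generated by $[x]-[y]+[\frac yx]-[\frac{1-x^{-1}}{1-y^{-1}}]+[\frac{1-x}{1-y}]$, $x\ne y$. Then $\beta(K,z)=\sum_{\nu=1}^N\big([z_{12}(T_\nu)]+[z_{21}(T_\nu)]+[z_{34}(T_\nu)]+[z_{43}(T_\nu)]\big)\in\mathcal{P}(\mathbb{C})$. The volume of $(K,z)$ is $\frac14 D(\beta(K,z))$, where $D:\mathcal{P}(\mathbb{C})\to\mathbb{R}$ is induced linearly by the Bloch–Wigner dilogarithm $D(x)=\arg(1-x)\log|x|-\mathrm{Im}\int_0^x\log(1-t)\frac{dt}{t}$. *)

theory Defs
  imports
    "HOL-Complex_Analysis.Contour_Integration"
    "HOL-Algebra.Free_Abelian_Groups"
    "HOL-Algebra.Coset"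
    "HOL-Combinatorics.Permutations"
begin

section \<open>Flags of the complex projective plane\<close>

text \<open>
  Points of \<open>P(V)\<close> and of \<open>P(V\<^sup>*)\<close>, for \<open>V = \<complex>\<^sup>3\<close>, are given by homogeneous coordinates, a functional
  \<open>f\<close> being given by its coordinates in the dual basis, so that \<open>f(x)\<close> is the bilinear
  \<open>scalar_product f x\<close>.  A pair \<open>(x, f)\<close> stands for the flag \<open>([x], [f])\<close>, and a family of four
  such pairs stands for the configuration that it represents.  What follows does not depend on
  the chosen representatives: see \<open>zcoord_rescale\<close>, \<open>zcoord_linear\<close> and \<open>ztriple_rescale\<close>,
  \<open>ztriple_linear\<close> below.
\<close>

type_synonym flag = "(complex^3) \<times> (complex^3)"

definition is_flag :: "flag \<Rightarrow> bool" where
  "is_flag F \<longleftrightarrow> fst F \<noteq> 0 \<and> snd F \<noteq> 0 \<and> scalar_product (snd F) (fst F) = 0"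

definition dual_flag :: "flag \<Rightarrow> flag" where
  "dual_flag F = (snd F, fst F)"

definition collinear_points :: "complex^3 \<Rightarrow> complex^3 \<Rightarrow> complex^3 \<Rightarrow> bool" where
  "collinear_points x y z \<longleftrightarrow>
     (\<exists>g. g \<noteq> 0 \<and> scalar_product g x = 0 \<and> scalar_product g y = 0 \<and> scalar_product g z = 0)"

definition concurrent_lines :: "complex^3 \<Rightarrow> complex^3 \<Rightarrow> complex^3 \<Rightarrow> bool" where
  "concurrent_lines f g h \<longleftrightarrow>
     (\<exists>p. p \<noteq> 0 \<and> scalar_product f p = 0 \<and> scalar_product g p = 0 \<and> scalar_product h p = 0)"

abbreviation det3 :: "complex^3 \<Rightarrow> complex^3 \<Rightarrow> complex^3 \<Rightarrow> complex" where
  "det3 x y z \<equiv> det (vector [x, y, z] :: complex^3^3)"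


section \<open>Tetrahedra of flags and their coordinates\<close>

abbreviation verts :: "nat set" where
  "verts \<equiv> {1, 2, 3, 4}"

type_synonym tetra = "nat \<Rightarrow> flag"   \<comment> \<open>only the values on \<open>verts\<close> matter\<close>

definition generic_tetra :: "tetra \<Rightarrow> bool" where
  "generic_tetra T \<longleftrightarrow>
     (\<forall>i\<in>verts. is_flag (T i)) \<and>
     (\<forall>i\<in>verts. \<forall>j\<in>verts. i \<noteq> j \<longrightarrow> scalar_product (snd (T i)) (fst (T j)) \<noteq> 0) \<and>
     (\<forall>i\<in>verts. \<forall>j\<in>verts. \<forall>k\<in>verts. distinct [i, j, k] \<longrightarrow>
        \<not> collinear_points (fst (T i)) (fst (T j)) (fst (T k)))"

definition very_generic_tetra :: "tetra \<Rightarrow> bool" where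
  "very_generic_tetra T \<longleftrightarrow>
     generic_tetra T \<and>
     (\<forall>i\<in>verts. \<forall>j\<in>verts. \<forall>k\<in>verts. distinct [i, j, k] \<longrightarrow>
        \<not> concurrent_lines (snd (T i)) (snd (T j)) (snd (T k)))"

definition dual_tetra :: "tetra \<Rightarrow> tetra" where
  "dual_tetra T = (\<lambda>i. dual_flag (T i))"

definition even_order :: "nat \<Rightarrow> nat \<Rightarrow> nat \<Rightarrow> nat \<Rightarrow> bool" where
  "even_order i j k l \<longleftrightarrow>
     (\<exists>\<sigma>. \<sigma> permutes verts \<and> evenperm \<sigma> \<and> \<sigma> 1 = i \<and> \<sigma> 2 = j \<and> \<sigma> 3 = k \<and> \<sigma> 4 = l)"

text \<open>For distinct \<open>i, j\<close> in \<open>verts\<close> the pair \<open>(k, l)\<close> below is unique; see \<open>zcoord_eq\<close>.\<close>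

definition zcoord :: "tetra \<Rightarrow> nat \<Rightarrow> nat \<Rightarrow> complex" where
  "zcoord T i j =
     (let (k, l) = (THE (k, l). even_order i j k l);
          x = (\<lambda>m. fst (T m)); f = (\<lambda>m. snd (T m))
      in (scalar_product (f i) (x k) * det3 (x i) (x j) (x l)) /
         (scalar_product (f i) (x l) * det3 (x i) (x j) (x k)))"

definition ztriple :: "tetra \<Rightarrow> nat \<Rightarrow> nat \<Rightarrow> nat \<Rightarrow> complex" where
  "ztriple T i j k =
     (let x = (\<lambda>m. fst (T m)); f = (\<lambda>m. snd (T m))
      in (scalar_product (f i) (x j) * scalar_product (f j) (x k) * scalar_product (f k) (x i)) /
         (scalar_product (f i) (x k) * scalar_product (f j) (x i) * scalar_product (f k) (x j)))"


section \<open>Ideal triangulations\<close>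

text \<open>
  The simplices are \<open>T\<^sub>1, \<dots>, T\<^sub>N\<close> with \<open>N = num_tets K\<close>, each with vertices \<open>1, 2, 3, 4\<close> ordered
  compatibly with its orientation.  \<open>gluing K \<nu> l = Some (\<mu>, \<sigma>)\<close> means that the face of \<open>T\<^sub>\<nu>\<close>
  opposite to the vertex \<open>l\<close> is glued to the face of \<open>T\<^sub>\<mu>\<close> opposite to \<open>\<sigma> l\<close>, the vertex
  \<open>i \<noteq> l\<close> of \<open>T\<^sub>\<nu>\<close> going to the vertex \<open>\<sigma> i\<close> of \<open>T\<^sub>\<mu>\<close>; \<open>None\<close> means that the face is free.
\<close>

record quasi_complex =
  num_tets :: nat
  gluing :: "nat \<Rightarrow> nat \<Rightarrow> (nat \<times> (nat \<Rightarrow> nat)) option"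

text \<open>
  Faces are glued in pairs of distinct faces.  A positively oriented boundary face is \<open>(i, j, k)\<close>
  with \<open>(l, i, j, k)\<close> even, so the simplicial map between the two faces reverses the orientation
  iff its extension \<open>\<sigma>\<close> to the four vertices is odd.  As the gluings reverse the orientation, the
  complement of the vertices is an oriented manifold, and no edge is glued to itself reversed.
\<close>

definition ideal_triangulation :: "quasi_complex \<Rightarrow> bool" where
  "ideal_triangulation K \<longleftrightarrow>
     (\<forall>\<nu>\<in>{1..num_tets K}. \<forall>l\<in>verts. \<forall>\<mu> \<sigma>. gluing K \<nu> l = Some (\<mu>, \<sigma>) \<longrightarrow>
        \<mu> \<in> {1..num_tets K} \<and> \<sigma> permutes verts \<and> \<not> evenperm \<sigma> \<and>
        (\<mu>, \<sigma> l) \<noteq> (\<nu>, l) \<and> gluing K \<mu> (\<sigma> l) = Some (\<nu>, inv_into UNIV \<sigma>))"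

definition no_free_faces :: "quasi_complex \<Rightarrow> bool" where
  "no_free_faces K \<longleftrightarrow> (\<forall>\<nu>\<in>{1..num_tets K}. \<forall>l\<in>verts. gluing K \<nu> l \<noteq> None)"

text \<open>
  \<open>(\<nu>, i, j)\<close> is the edge \<open>ij\<close> of \<open>T\<^sub>\<nu>\<close>, oriented from \<open>i\<close> to \<open>j\<close>.  Face gluings generate the
  identification of oriented edges; as the inverse of a gluing is a gluing, the
  reflexive-transitive closure is symmetric.  A class is an oriented edge of \<open>|K|\<close>, and a simplex
  is counted once for each of its edges in the class.
\<close>

definition edge_step :: "quasi_complex \<Rightarrow> ((nat \<times> nat \<times> nat) \<times> (nat \<times> nat \<times> nat)) set" where
  "edge_step K = {((\<nu>, i, j), (\<mu>, \<sigma> i, \<sigma> j)) | \<nu> i j l \<mu> \<sigma>.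
     \<nu> \<in> {1..num_tets K} \<and> i \<in> verts \<and> j \<in> verts \<and> l \<in> verts \<and> distinct [i, j, l] \<and>
     gluing K \<nu> l = Some (\<mu>, \<sigma>)}"

definition edge_class :: "quasi_complex \<Rightarrow> nat \<times> nat \<times> nat \<Rightarrow> (nat \<times> nat \<times> nat) set" where
  "edge_class K e = (edge_step K)\<^sup>* `` {e}"


section \<open>Decorations\<close>

type_synonym decoration = "nat \<Rightarrow> tetra"

definition generic_decoration :: "quasi_complex \<Rightarrow> decoration \<Rightarrow> bool" where
  "generic_decoration K F \<longleftrightarrow> (\<forall>\<nu>\<in>{1..num_tets K}. generic_tetra (F \<nu>))"

definition face_equations :: "quasi_complex \<Rightarrow> decoration \<Rightarrow> bool" where
  "face_equations K F \<longleftrightarrow>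
     (\<forall>\<nu>\<in>{1..num_tets K}. \<forall>l i j k \<mu> \<sigma>.
        even_order l i j k \<and> gluing K \<nu> l = Some (\<mu>, \<sigma>) \<longrightarrow>
        ztriple (F \<nu>) i j k * ztriple (F \<mu>) (\<sigma> i) (\<sigma> k) (\<sigma> j) = 1)"

definition edge_equations :: "quasi_complex \<Rightarrow> decoration \<Rightarrow> bool" where
  "edge_equations K F \<longleftrightarrow>
     (\<forall>\<nu>\<in>{1..num_tets K}. \<forall>i\<in>verts. \<forall>j\<in>verts. i \<noteq> j \<longrightarrow>
        (\<Prod>(\<mu>, a, b)\<in>edge_class K (\<nu>, i, j). zcoord (F \<mu>) a b) = 1 \<and>
        (\<Prod>(\<mu>, a, b)\<in>edge_class K (\<nu>, i, j). zcoord (F \<mu>) b a) = 1)"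

definition Sol :: "quasi_complex \<Rightarrow> decoration set" where
  "Sol K = {F. generic_decoration K F \<and> face_equations K F \<and> edge_equations K F}"

definition very_generic_decoration :: "quasi_complex \<Rightarrow> decoration \<Rightarrow> bool" where
  "very_generic_decoration K F \<longleftrightarrow> (\<forall>\<nu>\<in>{1..num_tets K}. very_generic_tetra (F \<nu>))"

definition dual_decoration :: "decoration \<Rightarrow> decoration" where
  "dual_decoration F = (\<lambda>\<nu>. dual_tetra (F \<nu>))"


section \<open>The pre-Bloch group, the invariant and the volume\<close>

abbreviation free_symbols :: "(complex \<Rightarrow>\<^sub>0 int) monoid" where
  "free_symbols \<equiv> free_Abelian_group (- {0, 1})"

definition five_term :: "complex \<Rightarrow> complex \<Rightarrow> (complex \<Rightarrow>\<^sub>0 int)" where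
  "five_term x y =
     frag_of x - frag_of y + frag_of (y / x)
       - frag_of ((1 - inverse x) / (1 - inverse y)) + frag_of ((1 - x) / (1 - y))"

definition five_term_subgroup :: "(complex \<Rightarrow>\<^sub>0 int) set" where
  "five_term_subgroup =
     generate free_symbols {five_term x y | x y. x \<notin> {0, 1} \<and> y \<notin> {0, 1} \<and> x \<noteq> y}"

definition pre_Bloch :: "(complex \<Rightarrow>\<^sub>0 int) set monoid" where
  "pre_Bloch = free_symbols Mod five_term_subgroup"

definition pre_Bloch_class :: "(complex \<Rightarrow>\<^sub>0 int) \<Rightarrow> (complex \<Rightarrow>\<^sub>0 int) set" where
  "pre_Bloch_class c = five_term_subgroup #>\<^bsub>free_symbols\<^esub> c"

definition beta :: "quasi_complex \<Rightarrow> decoration \<Rightarrow> (complex \<Rightarrow>\<^sub>0 int) set" where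
  "beta K F = pre_Bloch_class
     (\<Sum>\<nu>\<in>{1..num_tets K}.
        frag_of (zcoord (F \<nu>) 1 2) + frag_of (zcoord (F \<nu>) 2 1) +
        frag_of (zcoord (F \<nu>) 3 4) + frag_of (zcoord (F \<nu>) 4 3))"

text \<open>
  Principal branches, integral along the segment from \<open>0\<close> to \<open>x\<close>.  For real \<open>x > 1\<close>, where the
  segment runs along the cut, both terms use the value \<open>\<pi>\<close> of the argument and the result is
  \<open>0\<close>, as it should be.
\<close>

definition Bloch_Wigner :: "complex \<Rightarrow> real" where
  "Bloch_Wigner x =
     Arg (1 - x) * ln (cmod x) - Im (contour_integral (linepath 0 x) (\<lambda>t. Ln (1 - t) / t))"

definition Bloch_Wigner_lin :: "(complex \<Rightarrow>\<^sub>0 int) \<Rightarrow> real" where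
  "Bloch_Wigner_lin c = (\<Sum>x\<in>Poly_Mapping.keys c. of_int (Poly_Mapping.lookup c x) * Bloch_Wigner x)"

text \<open>
  The map induced on the quotient: the value at a coset is the common value of the linear
  extension on the members of the coset.  That this value is common is the five-term relation
  of the Bloch-Wigner dilogarithm.
\<close>

definition Bloch_Wigner_ind :: "(complex \<Rightarrow>\<^sub>0 int) set \<Rightarrow> real" where
  "Bloch_Wigner_ind X = the_elem (Bloch_Wigner_lin ` X)"

definition volume :: "quasi_complex \<Rightarrow> decoration \<Rightarrow> real" where
  "volume K F = Bloch_Wigner_ind (beta K F) / 4"


section \<open>Basic facts on the definitions\<close>

lemma even_order_unique:
  assumes "even_order i j k l" "even_order i j k' l'"
  shows "k' = k \<and> l' = l"
proof (rule ccontr)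
  assume ne: "\<not> (k' = k \<and> l' = l)"
  obtain s where s: "s permutes verts" "evenperm s" "s 1 = i" "s 2 = j" "s 3 = k" "s 4 = l"
    using assms(1) unfolding even_order_def by blast
  obtain t where t: "t permutes verts" "evenperm t" "t 1 = i" "t 2 = j" "t 3 = k'" "t 4 = l'"
    using assms(2) unfolding even_order_def by blast
  have injs: "inj s" and injt: "inj t"
    using s(1) t(1) permutes_inj by auto
  have ds: "distinct [i, j, k, l]" and dt: "distinct [i, j, k', l']"
    using injD[OF injs, of 1 2] injD[OF injs, of 1 3] injD[OF injs, of 1 4] injD[OF injs, of 2 3]
      injD[OF injs, of 2 4] injD[OF injs, of 3 4]
      injD[OF injt, of 1 2] injD[OF injt, of 1 3] injD[OF injt, of 1 4] injD[OF injt, of 2 3]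
      injD[OF injt, of 2 4] injD[OF injt, of 3 4] s t by auto
  have "s ` verts = verts" "t ` verts = verts"
    using s(1) t(1) permutes_image by auto
  then have "{i, j, k, l} = {i, j, k', l'}"
    using s t by auto
  with ds dt ne have sw: "k' = l" "l' = k"
    by (auto simp: doubleton_eq_iff insert_eq_iff)
  have "t = s \<circ> Transposition.transpose 3 4"
  proof
    fix x
    show "t x = (s \<circ> Transposition.transpose 3 4) x"
    proof (cases "x \<in> verts")
      case True
      then show ?thesis using s t sw by (auto simp: Transposition.transpose_def)
    next
      case False
      then show ?thesis using s(1) t(1) by (auto simp: Transposition.transpose_def permutes_def)
    qed
  qed
  moreover have "\<not> evenperm (s \<circ> Transposition.transpose 3 4)"
    using s(1,2) permutes_imp_permutation[OF _ s(1)]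
    by (simp add: evenperm_comp permutation_swap_id evenperm_swap)
  ultimately show False using t(2) by simp
qed

lemma zcoord_eq:
  assumes "even_order i j k l"
  shows "zcoord T i j =
    (scalar_product (snd (T i)) (fst (T k)) * det3 (fst (T i)) (fst (T j)) (fst (T l))) /
    (scalar_product (snd (T i)) (fst (T l)) * det3 (fst (T i)) (fst (T j)) (fst (T k)))"
proof -
  have "(THE (k, l). even_order i j k l) = (k, l)"
    using assms even_order_unique by (intro the_equality) (auto dest: even_order_unique)
  then show ?thesis by (simp add: zcoord_def Let_def)
qed

lemma even_order_1234: "even_order 1 2 3 4"
  unfolding even_order_def by (intro exI[of _ id]) auto

lemma even_order_transposes:
  assumes "a \<in> verts" "b \<in> verts" "c \<in> verts" "d \<in> verts" "a \<noteq> b" "c \<noteq> d"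
    "i = Transposition.transpose a b (Transposition.transpose c d 1)"
    "j = Transposition.transpose a b (Transposition.transpose c d 2)"
    "k = Transposition.transpose a b (Transposition.transpose c d 3)"
    "l = Transposition.transpose a b (Transposition.transpose c d 4)"
  shows "even_order i j k l"
proof -
  let ?t = "Transposition.transpose a b \<circ> Transposition.transpose c d"
  have "?t permutes verts"
    by (intro permutes_compose permutes_swap_id assms)
  moreover have "evenperm ?t"
    using assms(5,6) by (simp add: evenperm_comp permutation_swap_id evenperm_swap)
  ultimately show ?thesis
    unfolding even_order_def by (intro exI[of _ ?t]) (simp add: assms)
qed

lemma even_orders:
  "even_order 1 2 3 4"
  "even_order 1 3 4 2"
  "even_order 1 4 2 3"
  "even_order 2 1 4 3"
  "even_order 2 3 1 4"
  "even_order 2 4 3 1"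
  "even_order 3 1 2 4"
  "even_order 3 2 4 1"
  "even_order 3 4 1 2"
  "even_order 4 1 3 2"
  "even_order 4 2 1 3"
  "even_order 4 3 2 1"
  subgoal by (rule even_order_1234)
  subgoal by (rule even_order_transposes[of 2 3 3 4]) (simp_all add: Transposition.transpose_def)
  subgoal by (rule even_order_transposes[of 2 3 2 4]) (simp_all add: Transposition.transpose_def)
  subgoal by (rule even_order_transposes[of 1 2 3 4]) (simp_all add: Transposition.transpose_def)
  subgoal by (rule even_order_transposes[of 1 2 2 3]) (simp_all add: Transposition.transpose_def)
  subgoal by (rule even_order_transposes[of 1 2 2 4]) (simp_all add: Transposition.transpose_def)
  subgoal by (rule even_order_transposes[of 1 2 1 3]) (simp_all add: Transposition.transpose_def)
  subgoal by (rule even_order_transposes[of 1 3 3 4]) (simp_all add: Transposition.transpose_def)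
  subgoal by (rule even_order_transposes[of 1 3 2 4]) (simp_all add: Transposition.transpose_def)
  subgoal by (rule even_order_transposes[of 1 2 1 4]) (simp_all add: Transposition.transpose_def)
  subgoal by (rule even_order_transposes[of 1 3 1 4]) (simp_all add: Transposition.transpose_def)
  subgoal by (rule even_order_transposes[of 1 4 2 3]) (simp_all add: Transposition.transpose_def)
  done

lemma even_order_verts:
  assumes "even_order i j k l"
  shows "i \<in> verts \<and> j \<in> verts \<and> k \<in> verts \<and> l \<in> verts \<and> distinct [i, j, k, l]"
proof -
  obtain s where s: "s permutes verts" "s 1 = i" "s 2 = j" "s 3 = k" "s 4 = l"
    using assms unfolding even_order_def by blast
  have injs: "inj s"
    using s(1) permutes_inj by auto
  have "distinct [i, j, k, l]"
    using injD[OF injs, of 1 2] injD[OF injs, of 1 3] injD[OF injs, of 1 4]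
      injD[OF injs, of 2 3] injD[OF injs, of 2 4] injD[OF injs, of 3 4] s by auto
  moreover have "s 1 \<in> verts" "s 2 \<in> verts" "s 3 \<in> verts" "s 4 \<in> verts"
    unfolding permutes_in_image[OF s(1)] by simp_all
  ultimately show ?thesis using s by simp
qed

lemma even_order_exists:
  assumes "i \<in> verts" "j \<in> verts" "i \<noteq> j"
  obtains k l where "even_order i j k l"
proof -
  have "\<exists>k l. even_order i j k l"
    by (insert assms even_orders, elim insertE emptyE; hypsubst; blast)
  then show ?thesis using that by blast
qed

lemma det3_scale: "det3 (a *s x) (b *s y) (c *s z) = a * b * c * det3 x y z"
  by (simp add: det_3 algebra_simps)

lemma scalar_product_scale: "scalar_product (a *s f) (b *s x) = a * b * scalar_product f x"
  for f x :: "complex^3"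
  by (simp add: scalar_product_def sum_3 algebra_simps)

lemma rescale_aux:
  fixes bi ai aj ak al :: complex
  assumes "bi \<noteq> 0" "ai \<noteq> 0" "aj \<noteq> 0" "ak \<noteq> 0" "al \<noteq> 0"
  shows "(bi * ak * X * (ai * aj * al * Y)) / (bi * al * Z * (ai * aj * ak * W)) = X * Y / (Z * W)"
proof -
  have "(bi * ak * X * (ai * aj * al * Y)) / (bi * al * Z * (ai * aj * ak * W)) =
      ((bi * ai * aj * ak * al) * (X * Y)) / ((bi * ai * aj * ak * al) * (Z * W))"
    by (simp only: mult_ac)
  also have "\<dots> = X * Y / (Z * W)"
    using assms by (intro mult_divide_mult_cancel_left) simp
  finally show ?thesis .
qed

lemma rescale_aux3:
  fixes ai aj ak bi bj bk :: complex
  assumes "ai \<noteq> 0" "aj \<noteq> 0" "ak \<noteq> 0" "bi \<noteq> 0" "bj \<noteq> 0" "bk \<noteq> 0"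
  shows "(bi * aj * X * (bj * ak * Y) * (bk * ai * Z)) /
    (bi * ak * X' * (bj * ai * Y') * (bk * aj * Z')) = X * Y * Z / (X' * Y' * Z')"
proof -
  have "(bi * aj * X * (bj * ak * Y) * (bk * ai * Z)) /
      (bi * ak * X' * (bj * ai * Y') * (bk * aj * Z')) =
      ((bi * bj * bk * ai * aj * ak) * (X * Y * Z)) / ((bi * bj * bk * ai * aj * ak) * (X' * Y' * Z'))"
    by (simp only: mult_ac)
  also have "\<dots> = X * Y * Z / (X' * Y' * Z')"
    using assms by (intro mult_divide_mult_cancel_left) simp
  finally show ?thesis .
qed

lemma zcoord_rescale:
  assumes "\<And>i. i \<in> verts \<Longrightarrow> a i \<noteq> 0 \<and> b i \<noteq> 0" "i \<in> verts" "j \<in> verts" "i \<noteq> j"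
  shows "zcoord (\<lambda>m. (a m *s fst (T m), b m *s snd (T m))) i j = zcoord T i j"
proof -
  obtain k l where kl: "even_order i j k l"
    using even_order_exists assms(2-4) .
  then have klv: "k \<in> verts" "l \<in> verts"
    using even_order_verts by auto
  show ?thesis
    unfolding zcoord_eq[OF kl] fst_conv snd_conv det3_scale scalar_product_scale
    using assms(1)[OF assms(2)] assms(1)[OF assms(3)] assms(1)[OF klv(1)] assms(1)[OF klv(2)]
    by (intro rescale_aux) auto
qed

lemma ztriple_rescale:
  assumes "\<And>i. i \<in> verts \<Longrightarrow> a i \<noteq> 0 \<and> b i \<noteq> 0" "i \<in> verts" "j \<in> verts" "k \<in> verts"
  shows "ztriple (\<lambda>m. (a m *s fst (T m), b m *s snd (T m))) i j k = ztriple T i j k"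
  unfolding ztriple_def Let_def fst_conv snd_conv scalar_product_scale
  using assms(1)[OF assms(2)] assms(1)[OF assms(3)] assms(1)[OF assms(4)]
  by (intro rescale_aux3) auto

lemma scalar_product_linear:
  fixes A B :: "complex^3^3"
  assumes "B ** A = mat 1"
  shows "scalar_product (f v* B) (A *v x) = scalar_product f x"
proof -
  have sp: "scalar_product u w = (\<Sum>i\<in>UNIV. u $ i * w $ i)" for u w :: "complex^3"
    by (simp add: scalar_product_def)
  have "scalar_product (f v* B) (A *v x) = scalar_product f (B *v (A *v x))"
    by (simp add: sp vector_matrix_mult_def matrix_vector_mult_def sum_3 algebra_simps)
  also have "B *v (A *v x) = x"
    by (simp add: matrix_vector_mul_assoc assms)
  finally show ?thesis .
qed

lemma det3_linear: "det3 (A *v x) (A *v y) (A *v z) = det A * det3 x y z"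
  for A :: "complex^3^3"
  by (simp add: det_3 matrix_vector_mult_def sum_3 algebra_simps)

lemma zcoord_linear:
  fixes A B :: "complex^3^3"
  assumes AB: "B ** A = mat 1" and "i \<in> verts" "j \<in> verts" "i \<noteq> j"
  shows "zcoord (\<lambda>m. (A *v fst (T m), snd (T m) v* B)) i j = zcoord T i j"
proof -
  obtain k l where kl: "even_order i j k l"
    using even_order_exists assms(2-4) .
  have "det B * det A = 1"
    using AB by (metis det_I det_mul)
  then have "det A \<noteq> 0" by auto
  then show ?thesis
    by (simp add: zcoord_eq[OF kl] scalar_product_linear[OF AB] det3_linear)
qed

lemma ztriple_linear:
  fixes A B :: "complex^3^3"
  assumes "B ** A = mat 1"
  shows "ztriple (\<lambda>m. (A *v fst (T m), snd (T m) v* B)) i j k = ztriple T i j k"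
  by (simp add: ztriple_def scalar_product_linear[OF assms])

lemma scalar_product_commute: "scalar_product x y = scalar_product y x" for x y :: "complex^3"
  by (simp add: scalar_product_def mult.commute)

lemma collinear_points_iff_det: "collinear_points x y z \<longleftrightarrow> det3 x y z = 0"
proof -
  let ?A = "vector [x, y, z] :: complex^3^3"
  have "?A *v g = 0 \<longleftrightarrow>
      scalar_product g x = 0 \<and> scalar_product g y = 0 \<and> scalar_product g z = 0" for g
    by (simp add: vec_eq_iff matrix_vector_mult_def scalar_product_def sum_3 forall_3 mult.commute)
  then have "collinear_points x y z \<longleftrightarrow> \<not> (\<forall>g. ?A *v g = 0 \<longrightarrow> g = 0)"
    unfolding collinear_points_def by blast
  also have "\<dots> \<longleftrightarrow> \<not> invertible ?A"
    by (simp add: matrix_left_invertible_ker[symmetric] invertible_left_inverse)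
  finally show ?thesis by (simp add: invertible_det_nz)
qed

lemma concurrent_lines_iff_det: "concurrent_lines f g h \<longleftrightarrow> det3 f g h = 0"
proof -
  have "concurrent_lines f g h \<longleftrightarrow> collinear_points f g h"
    unfolding collinear_points_def concurrent_lines_def
    using scalar_product_commute by metis
  then show ?thesis by (simp add: collinear_points_iff_det)
qed

lemma very_generic_tetra_dual:
  assumes "very_generic_tetra T"
  shows "very_generic_tetra (dual_tetra T)"
  using assms
  unfolding very_generic_tetra_def generic_tetra_def dual_tetra_def dual_flag_def is_flag_def
    collinear_points_iff_det concurrent_lines_iff_det fst_conv snd_conv
  by (simp add: scalar_product_commute[of "fst _" "snd _"])

lemma zcoord_not_0_1:
  assumes T: "generic_tetra T" and ij: "i \<in> verts" "j \<in> verts" "i \<noteq> j"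
  shows "zcoord T i j \<notin> {0, 1}"
proof -
  obtain k l where ord: "even_order i j k l"
    using even_order_exists ij .
  note kl = ord even_order_verts[OF ord]
  define x where "x = (\<lambda>m. fst (T m))"
  define f where "f = snd (T i)"
  have nz: "scalar_product f (x j) \<noteq> 0" "scalar_product f (x k) \<noteq> 0" "scalar_product f (x l) \<noteq> 0"
    and z: "scalar_product f (x i) = 0"
    using T ij kl unfolding generic_tetra_def is_flag_def f_def x_def by auto
  have "\<not> collinear_points (x a) (x b) (x c)"
    if "a \<in> verts" "b \<in> verts" "c \<in> verts" "distinct [a, b, c]" for a b c
    using T that unfolding generic_tetra_def x_def by blast
  then have d: "det3 (x i) (x j) (x k) \<noteq> 0" "det3 (x i) (x j) (x l) \<noteq> 0" "det3 (x i) (x k) (x l) \<noteq> 0"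
    using ij kl by (auto simp flip: collinear_points_iff_det)
  have "det3 (x j) (x k) (x l) * scalar_product f (x i)
      - det3 (x i) (x k) (x l) * scalar_product f (x j)
      + det3 (x i) (x j) (x l) * scalar_product f (x k)
      - det3 (x i) (x j) (x k) * scalar_product f (x l) = 0"
    by (simp add: det_3 scalar_product_def sum_3 algebra_simps)
  then have "scalar_product f (x k) * det3 (x i) (x j) (x l)
      - scalar_product f (x l) * det3 (x i) (x j) (x k)
      = det3 (x i) (x k) (x l) * scalar_product f (x j)"
    using z by (simp add: algebra_simps)
  then have "scalar_product f (x k) * det3 (x i) (x j) (x l)
      \<noteq> scalar_product f (x l) * det3 (x i) (x j) (x k)"
    using d nz by auto
  moreover have "zcoord T i j = (scalar_product f (x k) * det3 (x i) (x j) (x l)) /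
      (scalar_product f (x l) * det3 (x i) (x j) (x k))"
    using zcoord_eq[OF kl(1), of T] by (simp only: f_def x_def)
  ultimately show ?thesis using d nz by auto
qed

lemma beta_in_pre_Bloch:
  assumes "generic_decoration K F"
  shows "beta K F \<in> carrier pre_Bloch"
proof -
  have mem: "frag_of (zcoord (F \<nu>) i j) \<in> carrier free_symbols"
    if "\<nu> \<in> {1..num_tets K}" "i \<in> verts" "j \<in> verts" "i \<noteq> j" for \<nu> i j
    using zcoord_not_0_1[of "F \<nu>" i j] assms that
    by (auto simp: generic_decoration_def carrier_free_Abelian_group_iff)
  have add: "c + d \<in> carrier free_symbols"
    if "c \<in> carrier free_symbols" "d \<in> carrier free_symbols" for c d
    using that Poly_Mapping.keys_add[of c d] by (auto simp: carrier_free_Abelian_group_iff)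
  have sum: "(\<Sum>\<nu>\<in>S. g \<nu>) \<in> carrier free_symbols"
    if "finite S" "\<And>\<nu>. \<nu> \<in> S \<Longrightarrow> g \<nu> \<in> carrier free_symbols" for S :: "nat set" and g
    using that
  proof (induction rule: finite_induct)
    case empty
    then show ?case by (simp add: carrier_free_Abelian_group_iff)
  next
    case (insert \<nu> S)
    have "g \<nu> + sum g S \<in> carrier free_symbols"
      by (intro add insert.IH insert.prems) simp_all
    then show ?case using insert.hyps by simp
  qed
  have "(\<Sum>\<nu>\<in>{1..num_tets K}.
        frag_of (zcoord (F \<nu>) 1 2) + frag_of (zcoord (F \<nu>) 2 1) +
        frag_of (zcoord (F \<nu>) 3 4) + frag_of (zcoord (F \<nu>) 4 3)) \<in> carrier free_symbols"
    by (intro sum add mem) simp_all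
  then show ?thesis
    by (auto simp: beta_def pre_Bloch_class_def pre_Bloch_def FactGroup_def RCOSETS_def)
qed

end

theory Submission
  imports Defs
begin

text \<open>
  Duality changes the symbol \<open>\<beta>(T) = [z\<^sub>1\<^sub>2] + [z\<^sub>2\<^sub>1] + [z\<^sub>3\<^sub>4] + [z\<^sub>4\<^sub>3]\<close> of a single very generic tetrahedron of flags
  only by contributions of its faces: in the pre-Bloch group,
  \<open>\<beta>(T) - \<beta>(T\<^sup>*) + \<Sum> [- z\<^sub>i\<^sub>j\<^sub>k(T)] = 0\<close>, summed over the four faces \<open>(ijk)\<close> with their boundary
  orientation (\<open>tetra_symbol_dual\<close>).  The face equation says that the triple ratios of two glued faces are
  inverse to each other, and \<open>[1/x] = - [x]\<close>, so the face contributions cancel in pairs when all faces are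
  glued (\<open>sum_tetra_symbol_dual\<close>).  The volume is a function of \<open>\<beta>\<close>.

  The identity for one tetrahedron comes from five-term relations.  A five-term relation
  belongs to five points of a projective line, its terms being the cross-ratios of four of them
  (\<open>five_point_relation\<close>).  The arguments \<open>z\<^sub>i\<^sub>j\<close>, their duals and the \<open>- z\<^sub>i\<^sub>j\<^sub>k\<close> are all cross-ratios of lines through
  one of the four points, or of points on one of the four lines, and six five-point relations combine to
  the identity (\<open>duality_identity\<close>).  That such cross-ratios may be compared up to reordering rests on
  \<open>[1/x] = - [x]\<close> and \<open>[1 - x] = - [x]\<close>, which follow from the five-term relation over \<open>\<complex>\<close>
  (\<open>B_inverse\<close>, \<open>B_complement\<close>).  Auxiliary points of the configuration may coincide; a cross-ratio with
  coinciding points counts as \<open>0\<close>, and the five-point relation is proved in this generality.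
\<close>

section \<open>Functions with the five-term relation\<close>

text \<open>
  Nonzero vectors of \<open>\<complex>\<^sup>2\<close> serve as homogeneous coordinates of points of the projective line; the bracket
  vanishes on two of them iff they represent the same point.
\<close>

definition bracket :: "complex \<times> complex \<Rightarrow> complex \<times> complex \<Rightarrow> complex" where
  "bracket u v = fst u * snd v - snd u * fst v"

lemma bracket_swap: "bracket v u = - bracket u v"
  by (simp add: bracket_def)

lemma pluecker: "bracket u v * bracket w x - bracket u w * bracket v x + bracket u x * bracket v w = 0"
  by (simp add: bracket_def algebra_simps)

lemma parallel_brackets:
  assumes "a \<noteq> (0, 0)" "b \<noteq> (0, 0)" "bracket a b = 0"
  shows "\<exists>t. t \<noteq> 0 \<and> (\<forall>w. bracket b w = t * bracket a w)"
proof -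
  obtain a1 a2 b1 b2 where ab: "a = (a1, a2)" "b = (b1, b2)" by fastforce
  have par: "a1 * b2 = a2 * b1" using assms(3) by (simp add: bracket_def ab)
  show ?thesis
  proof (cases "a1 = 0")
    case True
    then have "a2 \<noteq> 0" "b1 = 0" "b2 \<noteq> 0" using assms par by (auto simp: ab)
    with True show ?thesis by (intro exI[of _ "b2 / a2"]) (simp add: bracket_def ab)
  next
    case False
    then have b2: "b2 = a2 * (b1 / a1)" using par by (simp add: field_simps)
    then have "b1 \<noteq> 0" using assms by (auto simp: ab)
    with False show ?thesis by (intro exI[of _ "b1 / a1"]) (simp add: bracket_def ab b2 algebra_simps)
  qed
qed

text \<open>
  Setting the values at \<open>0\<close> and \<open>1\<close> to \<open>0\<close> is what makes degenerate positions harmless: a cross-ratio of four points some of which coincide is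
  \<open>0\<close>, \<open>1\<close> or a quotient with denominator \<open>0\<close>, hence also \<open>0\<close>, and so contributes nothing.
\<close>

locale five_term_function =
  fixes B :: "complex \<Rightarrow> 'a::ab_group_add"
  assumes at_0 [simp]: "B 0 = 0"
    and at_1 [simp]: "B 1 = 0"
    and five_term: "\<lbrakk>x \<notin> {0, 1}; y \<notin> {0, 1}; x \<noteq> y\<rbrakk> \<Longrightarrow>
      B x - B y + B (y / x) - B ((1 - inverse x) / (1 - inverse y)) + B ((1 - x) / (1 - y)) = 0"
begin

text \<open>
  Both symmetries \<open>B (1 / x) = - B x\<close> and \<open>B (1 - x) = - B x\<close> hold exactly, without torsion, because \<open>\<complex>\<close> has
  square roots and a primitive sixth root of unity.  Adding the five-term relations of \<open>(x, y)\<close> and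
  \<open>(y, x)\<close> leaves a relation between the three defects of \<open>y / x\<close>, \<open>(1 - x) / (1 - y)\<close> and their product,
  that is, the defect is multiplicative.
\<close>

definition inversion_defect :: "complex \<Rightarrow> 'a" where
  "inversion_defect u = B u + B (inverse u)"

lemma inversion_defect_mult:
  assumes u: "u \<notin> {0, 1}" and v: "v \<notin> {0, 1}" and uv: "u * v \<noteq> 1"
  shows "inversion_defect (u * v) = inversion_defect u + inversion_defect v"
proof -
  \<comment> \<open>the solution of \<open>y / x = u\<close>, \<open>(1 - x) / (1 - y) = v\<close>\<close>
  define x where "x = (1 - v) / (1 - u * v)"
  define y where "y = u * x"
  have nz: "1 - u * v \<noteq> 0" "1 - v \<noteq> 0" "1 - u \<noteq> 0" "u \<noteq> 0" "v \<noteq> 0" using assms by auto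
  have x0: "x \<noteq> 0" using nz by (simp add: x_def)
  have x1: "1 - x = v * (1 - u) / (1 - u * v)"
    using nz(1) by (simp add: x_def divide_simps) (simp add: algebra_simps)
  have y1: "1 - y = (1 - u) / (1 - u * v)"
    using nz(1) by (simp add: x_def y_def divide_simps) (simp add: algebra_simps)
  have "1 - x \<noteq> 0" "1 - y \<noteq> 0" unfolding x1 y1 using nz by auto
  then have ne: "x \<notin> {0, 1}" "y \<notin> {0, 1}" "x \<noteq> y" "y \<noteq> x"
    using x0 nz by (auto simp: y_def)
  have r1: "y / x = u" "x / y = inverse u" using x0 nz by (auto simp: y_def field_simps)
  have r2: "(1 - x) / (1 - y) = v" "(1 - y) / (1 - x) = inverse v"
    unfolding x1 y1 using nz by (auto simp: divide_simps)
  have inv: "1 - inverse z = - ((1 - z) / z)" if "z \<noteq> 0" for z :: complex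
    using that by (simp add: field_simps)
  have "y \<noteq> 0" using ne by auto
  have "(1 - inverse x) / (1 - inverse y) = ((1 - x) / (1 - y)) * (y / x)"
       "(1 - inverse y) / (1 - inverse x) = ((1 - y) / (1 - x)) * (x / y)"
    unfolding inv[OF x0] inv[OF \<open>y \<noteq> 0\<close>] by (simp_all add: mult_ac)
  then have r3: "(1 - inverse x) / (1 - inverse y) = u * v"
     "(1 - inverse y) / (1 - inverse x) = inverse (u * v)"
    unfolding r1 r2 by simp_all
  have "inversion_defect u + inversion_defect v - inversion_defect (u * v) =
      (B x - B y + B u - B (u * v) + B v) + (B y - B x + B (inverse u) - B (inverse (u * v)) + B (inverse v))"
    by (simp add: inversion_defect_def algebra_simps)
  also have "\<dots> = 0"
    using five_term[OF ne(1,2,3)] five_term[OF ne(2,1,4)] unfolding r1 r2 r3 by simp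
  finally show ?thesis by simp
qed

text \<open>
  With \<open>u = w\<^sup>2\<close>, multiplicativity for \<open>w = u \<cdot> w\<^sup>-\<^sup>1\<close> gives \<open>defect w = defect u + defect w\<^sup>-\<^sup>1\<close>; as the
  defects of \<open>w\<close> and \<open>w\<^sup>-\<^sup>1\<close> agree, that of \<open>u\<close> vanishes.
\<close>

lemma B_inverse: "B (inverse u) = - B u"
proof -
  have "inversion_defect u = 0" if "u \<notin> {0, 1}"
  proof -
    define w where "w = csqrt u"
    have w: "u = w * w" by (simp add: w_def flip: power2_eq_square)
    have nw: "inverse w \<notin> {0, 1}" "u * inverse w = w" "w \<noteq> 1" using that by (auto simp: w)
    have "inversion_defect w = inversion_defect u + inversion_defect (inverse w)"
      using inversion_defect_mult[OF that nw(1)] nw by simp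
    moreover have "inversion_defect (inverse w) = inversion_defect w"
      by (simp add: inversion_defect_def add.commute)
    ultimately show ?thesis by simp
  qed
  then show ?thesis by (cases "u \<in> {0, 1}") (auto simp: inversion_defect_def add_eq_0_iff)
qed

lemma B_divide_swap: "B (q / p) = - B (p / q)"
  using B_inverse[of "p / q"] by simp

text \<open>
  The pairs \<open>(x, y)\<close> and \<open>(1 - y, 1 - x)\<close> have the same last three terms, up to order, in their five-term
  relations.
\<close>

lemma complement_constant:
  assumes "x \<notin> {0, 1}" "y \<notin> {0, 1}"
  shows "B x + B (1 - x) = B y + B (1 - y)"
proof (cases "x = y")
  case False
  have ne: "1 - y \<notin> {0, 1}" "1 - x \<notin> {0, 1}" "1 - y \<noteq> 1 - x"
    using assms False by auto
  have "(1 - inverse (1 - y)) / (1 - inverse (1 - x)) = (1 - inverse x) / (1 - inverse y)"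
    using assms False by (simp add: divide_simps) (simp add: algebra_simps)
  then have "B (1 - y) - B (1 - x) + B ((1 - x) / (1 - y)) - B ((1 - inverse x) / (1 - inverse y))
      + B (y / x) = 0"
    using five_term[OF ne] by simp
  then have "B x - B y + B (y / x) - B ((1 - inverse x) / (1 - inverse y)) + B ((1 - x) / (1 - y)) -
     (B (1 - y) - B (1 - x) + B ((1 - x) / (1 - y)) - B ((1 - inverse x) / (1 - inverse y)) + B (y / x)) = 0"
    using five_term[OF assms False] by simp
  then have "(B x + B (1 - x)) - (B y + B (1 - y)) = 0"
    by (simp add: algebra_simps)
  then show ?thesis by simp
qed simp

text \<open>
  The constant is found at a primitive sixth root of unity \<open>w\<close>, where \<open>1 - w = w\<^sup>-\<^sup>1\<close>.
\<close>

lemma B_complement: "B (1 - x) = - B x"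
proof (cases "x \<in> {0, 1}")
  case False
  define w where "w = cis (pi / 3)"
  have w: "w + inverse w = 1" by (simp add: w_def complex_eq_iff cos_60)
  have "w \<notin> {0, 1}" using w by auto
  from complement_constant[OF False this]
  have "B x + B (1 - x) = B w + B (inverse w)" using w by (metis add_diff_cancel_left')
  then show ?thesis by (simp add: B_inverse add_eq_0_iff)
qed auto

lemma B_quotient_complement: "B ((q - p) / q) = - B (p / q)"
  using B_complement[of "p / q"] by (cases "q = 0") (simp_all add: diff_divide_distrib)

lemma B_numerator_complement: "B ((p - q) / p) = B (p / q)"
  using B_quotient_complement[of p q] B_divide_swap[of p q] by simp

lemma B_inverse_complement: "B (q / (q - p)) = B (p / q)"
  using B_quotient_complement[of q p] B_divide_swap[of q "q - p"] by simp

lemma B_reflected: "B (p / (p - q)) = - B (p / q)"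
  using B_numerator_complement[of p q] B_divide_swap[of p "p - q"] by simp


section \<open>Five points of the projective line\<close>

definition cross_symbol ::
    "complex \<times> complex \<Rightarrow> complex \<times> complex \<Rightarrow> complex \<times> complex \<Rightarrow> complex \<times> complex \<Rightarrow> 'a" where
  "cross_symbol u v w x = B (bracket u w * bracket v x / (bracket u x * bracket v w))"

lemma cross_symbol_swap_12: "cross_symbol v u w x = - cross_symbol u v w x"
  unfolding cross_symbol_def
  using B_divide_swap[of "bracket u w * bracket v x" "bracket u x * bracket v w"]
  by (simp add: mult.commute)

lemma cross_symbol_swap_34: "cross_symbol u v x w = - cross_symbol u v w x"
  unfolding cross_symbol_def
  using B_divide_swap[of "bracket u w * bracket v x" "bracket u x * bracket v w"] by simp

lemma cross_symbol_swap_23: "cross_symbol u w v x = - cross_symbol u v w x"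
proof (cases "bracket u x * bracket v w = 0")
  case True
  then have "bracket u x = 0 \<or> bracket w v = 0"
    using bracket_swap[of w v] by auto
  with True show ?thesis unfolding cross_symbol_def by auto
next
  case False
  have "bracket u v * bracket w x / (bracket u x * bracket w v) =
      1 - bracket u w * bracket v x / (bracket u x * bracket v w)"
    using False pluecker[of u v w x] unfolding bracket_swap[of w v]
    by (simp add: divide_simps) (simp add: algebra_simps)
  then show ?thesis unfolding cross_symbol_def by (simp only: B_complement)
qed

text \<open>
  This is the five-term relation of \<open>x\<close> and \<open>y\<close>, the cross-ratios of \<open>(a, b, c, d)\<close> and \<open>(a, b, c, e)\<close>: in
  the affine coordinate with \<open>a, b, c\<close> at \<open>\<infinity>, 0, 1\<close> these are the coordinates of \<open>d\<close> and \<open>e\<close>.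
\<close>

lemma five_point_sum_distinct:
  assumes "bracket a b \<noteq> 0" "bracket a c \<noteq> 0" "bracket a d \<noteq> 0" "bracket a e \<noteq> 0" "bracket b c \<noteq> 0"
    "bracket b d \<noteq> 0" "bracket b e \<noteq> 0" "bracket c d \<noteq> 0" "bracket c e \<noteq> 0" "bracket d e \<noteq> 0"
  shows "cross_symbol b c d e - cross_symbol a c d e + cross_symbol a b d e
     - cross_symbol a b c e + cross_symbol a b c d = 0"
proof -
  define x where "x = bracket a c * bracket b d / (bracket a d * bracket b c)"
  define y where "y = bracket a c * bracket b e / (bracket a e * bracket b c)"
  have x1: "1 - x = - (bracket a b * bracket c d / (bracket a d * bracket b c))"
    using pluecker[of a b c d] assms by (simp add: x_def divide_simps) (simp add: algebra_simps)
  have y1: "1 - y = - (bracket a b * bracket c e / (bracket a e * bracket b c))"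
    using pluecker[of a b c e] assms by (simp add: y_def divide_simps) (simp add: algebra_simps)
  have xy: "y - x = bracket a c * bracket a b * bracket d e / (bracket a e * bracket b c * bracket a d)"
    using pluecker[of a b d e] assms
    by (simp add: x_def y_def divide_simps) algebra
  have "x \<noteq> 0" "y \<noteq> 0" "1 - x \<noteq> 0" "1 - y \<noteq> 0" "y - x \<noteq> 0"
    unfolding x1 y1 xy using assms by (simp_all add: x_def y_def)
  then have ne: "x \<notin> {0, 1}" "y \<notin> {0, 1}" "x \<noteq> y" by auto
  have r1: "y / x = bracket a d * bracket b e / (bracket a e * bracket b d)"
    using assms by (simp add: x_def y_def)
  have r2: "(1 - x) / (1 - y) = (bracket a e * bracket c d) / (bracket a d * bracket c e)"
    unfolding x1 y1 using assms by simp
  have "(1 - inverse x) / (1 - inverse y) = ((1 - x) / (1 - y)) * (y / x)"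
    using ne by (simp add: divide_simps) (simp add: algebra_simps)
  also have "\<dots> = (bracket b e * bracket c d) / (bracket b d * bracket c e)"
    unfolding r1 r2 using assms by (simp add: mult.commute)
  finally have r3: "(1 - inverse x) / (1 - inverse y) = (bracket b e * bracket c d) / (bracket b d * bracket c e)" .
  have "cross_symbol a b c d = B x" "cross_symbol a b c e = B y" "cross_symbol a b d e = B (y / x)"
    unfolding cross_symbol_def r1 by (simp_all only: x_def y_def)
  moreover have "cross_symbol a c d e = - B ((1 - x) / (1 - y))"
    unfolding cross_symbol_def r2 by (subst B_divide_swap) (simp add: mult.commute)
  moreover have "cross_symbol b c d e = - B ((1 - inverse x) / (1 - inverse y))"
    unfolding cross_symbol_def r3 by (subst B_divide_swap) (rule refl)
  ultimately show ?thesis using five_term[OF ne] by (simp add: algebra_simps)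
qed

definition five_point_sum ::
    "complex \<times> complex \<Rightarrow> complex \<times> complex \<Rightarrow> complex \<times> complex \<Rightarrow> complex \<times> complex \<Rightarrow> complex \<times> complex \<Rightarrow> 'a" where
  "five_point_sum a b c d e = cross_symbol b c d e - cross_symbol a c d e + cross_symbol a b d e
     - cross_symbol a b c e + cross_symbol a b c d"

lemma five_point_sum_swap:
  "five_point_sum b a c d e = - five_point_sum a b c d e"
  "five_point_sum a c b d e = - five_point_sum a b c d e"
  "five_point_sum a b d c e = - five_point_sum a b c d e"
  "five_point_sum a b c e d = - five_point_sum a b c d e"
  unfolding five_point_sum_def
  using cross_symbol_swap_12[of b a] cross_symbol_swap_12[of c b] cross_symbol_swap_23[of a c b] cross_symbol_swap_23[of b d c]
    cross_symbol_swap_23[of a d c] cross_symbol_swap_34[of a b d c] cross_symbol_swap_34[of _ _ e d] by simp_all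

lemma five_point_sum_coincident:
  assumes "a \<noteq> (0, 0)" "b \<noteq> (0, 0)" "bracket a b = 0"
  shows "five_point_sum a b c d e = 0"
proof -
  obtain t where t: "t \<noteq> 0" "\<And>w. bracket b w = t * bracket a w"
    using parallel_brackets[OF assms] by blast
  have "cross_symbol b v w x = cross_symbol a v w x" for v w x
    using t(1) by (simp add: cross_symbol_def t(2) mult.assoc)
  moreover have "cross_symbol a b v w = 0" for v w
    using t(1) by (simp add: cross_symbol_def t(2))
  ultimately show ?thesis by (simp add: five_point_sum_def)
qed

lemma five_point_sum_zero_swap:
  "five_point_sum b a c d e = 0 \<Longrightarrow> five_point_sum a b c d e = 0"
  "five_point_sum a c b d e = 0 \<Longrightarrow> five_point_sum a b c d e = 0"
  "five_point_sum a b d c e = 0 \<Longrightarrow> five_point_sum a b c d e = 0"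
  "five_point_sum a b c e d = 0 \<Longrightarrow> five_point_sum a b c d e = 0"
  using five_point_sum_swap[of a b c d e] by simp_all

text \<open>
  The points need not be distinct.  The five-point sum is alternating, so two coinciding points can be
  moved to the first two places, where three terms are degenerate and the other two cancel.  This
  generality is what makes the relations available at special positions of auxiliary points of a
  very generic tetrahedron.
\<close>

theorem five_point_relation:
  assumes nz: "a \<noteq> (0, 0)" "b \<noteq> (0, 0)" "c \<noteq> (0, 0)" "d \<noteq> (0, 0)" "e \<noteq> (0, 0)"
  shows "five_point_sum a b c d e = 0"
proof -
  note swap12 = five_point_sum_zero_swap(1) and swap23 = five_point_sum_zero_swap(2)
    and swap34 = five_point_sum_zero_swap(3) and swap45 = five_point_sum_zero_swap(4)
  note coin = five_point_sum_coincident
  have "five_point_sum a b c d e = 0" if "bracket a b = 0"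
    by (rule coin) fact+
  moreover have "five_point_sum a b c d e = 0" if "bracket a c = 0"
    by (rule swap23, rule coin) fact+
  moreover have "five_point_sum a b c d e = 0" if "bracket a d = 0"
    by (rule swap34, rule swap23, rule coin) fact+
  moreover have "five_point_sum a b c d e = 0" if "bracket a e = 0"
    by (rule swap45, rule swap34, rule swap23, rule coin) fact+
  moreover have "five_point_sum a b c d e = 0" if "bracket b c = 0"
    by (rule swap12, rule swap23, rule coin) fact+
  moreover have "five_point_sum a b c d e = 0" if "bracket b d = 0"
    by (rule swap34, rule swap12, rule swap23, rule coin) fact+
  moreover have "five_point_sum a b c d e = 0" if "bracket b e = 0"
    by (rule swap45, rule swap34, rule swap12, rule swap23, rule coin) fact+
  moreover have "five_point_sum a b c d e = 0" if "bracket c d = 0"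
    by (rule swap23, rule swap12, rule swap34, rule swap23, rule coin) fact+
  moreover have "five_point_sum a b c d e = 0" if "bracket c e = 0"
    by (rule swap45, rule swap23, rule swap12, rule swap34, rule swap23, rule coin) fact+
  moreover have "five_point_sum a b c d e = 0" if "bracket d e = 0"
    by (rule swap34, rule swap45, rule swap23, rule swap12, rule swap34, rule swap23, rule coin) fact+
  ultimately show ?thesis
    using five_point_sum_distinct[of a b c d e] unfolding five_point_sum_def by blast
qed


section \<open>The duality identity in four parameters\<close>

text \<open>
  In coordinates with \<open>x\<^sub>1 = (1, 0, 0)\<close>, \<open>x\<^sub>2 = (0, 1, 0)\<close>, \<open>x\<^sub>3 = (0, 0, 1)\<close>, \<open>x\<^sub>4 = (1, 1, 1)\<close>,
  \<open>f\<^sub>1 = (0, 1, a)\<close>, \<open>f\<^sub>2 = (1, 0, b)\<close>, \<open>f\<^sub>3 = (1, c, 0)\<close>, \<open>f\<^sub>4 = (1, d, - 1 - d)\<close>, the first line consists of the symbols of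
  \<open>z\<^sub>1\<^sub>2, z\<^sub>2\<^sub>1, z\<^sub>3\<^sub>4, z\<^sub>4\<^sub>3\<close>, the second of those of the dual tetrahedron, and the third of those of \<open>- z\<^sub>i\<^sub>j\<^sub>k\<close> for the
  four positively oriented faces.  Here \<open>Eijk\<close> is the determinant of \<open>f\<^sub>i, f\<^sub>j, f\<^sub>k\<close>.  The names
  \<open>a', b', c', d'\<close> keep the sums \<open>1 + a, \<dots>\<close> atomic for rewriting.

  Write \<open>l\<^sub>i\<close> for the line of the flag \<open>i\<close> and \<open>p\<^sub>i\<^sub>j\<close> for the point \<open>l\<^sub>i \<inter> l\<^sub>j\<close>.  All twelve symbols are, up to
  the symmetries of the cross-ratio, cross-ratios of four of the following elements:
  \<^item> in the pencil of lines through \<open>x\<^sub>1\<close>: the line \<open>l = l\<^sub>1\<close>, the line \<open>ej\<close> through \<open>x\<^sub>j\<close> and the line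
    \<open>sjk\<close> through \<open>p\<^sub>j\<^sub>k\<close>;
  \<^item> on the line \<open>l\<^sub>2\<close>, which is mapped to that pencil by projection from \<open>x\<^sub>1\<close>: \<open>x\<^sub>2\<close> seen as \<open>e2\<close>, the points of
    the lines \<open>x\<^sub>1x\<^sub>3\<close>, \<open>x\<^sub>1x\<^sub>4\<close> seen as \<open>e3\<close>, \<open>e4\<close>, the point \<open>p\<^sub>2\<^sub>3\<close> seen as \<open>s23\<close>, and the point of
    \<open>x\<^sub>3x\<^sub>4\<close> seen as \<open>r\<close>;
  \<^item> in the pencil of lines through \<open>x\<^sub>4\<close>: the line \<open>k4 = l\<^sub>4\<close>, the line \<open>nj\<close> through \<open>x\<^sub>j\<close> and the line
    \<open>t\<close> through \<open>p\<^sub>2\<^sub>3\<close>.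

  Six five-point relations among these elements sum up to the identity: every other term occurs twice,
  with opposite signs, either literally or through one of four coincidences of cross-ratios.  If \<open>\<delta> = b - c\<close> vanishes, \<open>p\<^sub>2\<^sub>3\<close> lies on the line \<open>x\<^sub>1x\<^sub>4\<close>; this is compatible with the
  hypotheses and makes some of the relations degenerate, but not false.
\<close>

lemma duality_identity:
  fixes a b c d :: complex
  assumes nz: "a \<noteq> 0" "b \<noteq> 0" "c \<noteq> 0" "d \<noteq> 0" "a' \<noteq> 0" "b' \<noteq> 0" "c' \<noteq> 0" "d' \<noteq> 0"
    and succ: "a' = 1 + a" "b' = 1 + b" "c' = 1 + c" "d' = 1 + d"
    and Enz: "E123 \<noteq> 0" "E124 \<noteq> 0" "E134 \<noteq> 0" "E234 \<noteq> 0"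
    and E: "E123 = b + a * c" "E124 = b' + d * a'" "E134 = d' + a * d - a * c" "E234 = b * d - c * b' - c * d"
  shows "B (a / a') + B (b' / b) + B ((- 1) / c) + B ((- d) / 1)
    - (B (E124 / E123) + B ((d * E123) / (c * E124)) + B ((a * E234) / (b * E134)) + B ((b' * E134) / (a' * E234)))
    + (B ((b * c' * d) / (b' * c * d')) + B ((a' * d') / (a * c')) + B ((- b') / (a' * d)) + B ((- (a * c)) / b)) = 0"
proof -
  define \<delta> where "\<delta> = b - c"
  \<comment> \<open>the pencil at \<open>x\<^sub>1\<close>: the line through \<open>y\<close> has the coordinates \<open>(y\<^sub>2, y\<^sub>3)\<close>\<close>
  define l e2 e3 e4 where "l = (a, -1 :: complex)" and "e2 = (1 :: complex, 0 :: complex)"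
    and "e3 = (0 :: complex, 1 :: complex)" and "e4 = (1 :: complex, 1 :: complex)"
  define s23 s24 s34 where "s23 = (b, c)" and "s24 = (b' + d, d)" and "s34 = (d', d - c)"
  define r where "r = (b, -1 :: complex)"
  \<comment> \<open>the pencil at \<open>x\<^sub>4\<close>: the line through \<open>y\<close> has the coordinates \<open>(y\<^sub>1 - y\<^sub>3, y\<^sub>2 - y\<^sub>3)\<close>\<close>
  define k4 n1 n2 n3 t where "k4 = (d, -1 :: complex)" and "n1 = (1 :: complex, 0 :: complex)"
    and "n2 = (0 :: complex, 1 :: complex)" and "n3 = (-1 :: complex, -1 :: complex)"
    and "t = (- (c * b'), \<delta>)"
  note vecs = l_def e2_def e3_def e4_def s23_def s24_def s34_def r_def k4_def n1_def n2_def n3_def t_def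
  have vnz: "l \<noteq> (0,0)" "e2 \<noteq> (0,0)" "e3 \<noteq> (0,0)" "e4 \<noteq> (0,0)" "s23 \<noteq> (0,0)" "s24 \<noteq> (0,0)" "s34 \<noteq> (0,0)"
    "r \<noteq> (0,0)" "k4 \<noteq> (0,0)" "n1 \<noteq> (0,0)" "n2 \<noteq> (0,0)" "n3 \<noteq> (0,0)" "t \<noteq> (0,0)"
    using nz by (auto simp: vecs)
  have br: "bracket l e2 = 1" "bracket l e3 = a" "bracket l e4 = a'"
      "bracket l s23 = E123" "bracket l s24 = E124" "bracket l s34 = E134"
      "bracket e2 e3 = 1" "bracket e2 e4 = 1" "bracket e2 s23 = c" "bracket e2 s24 = d" "bracket e2 r = - 1"
      "bracket e3 e4 = - 1" "bracket e3 s23 = - b" "bracket e3 s34 = - d'" "bracket e3 r = - b"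
      "bracket e4 s23 = - \<delta>" "bracket e4 s24 = - b'" "bracket e4 s34 = - c'" "bracket e4 r = - b'"
      "bracket s23 s24 = E234" "bracket s23 s34 = E234" "bracket s24 s34 = E234"
      "bracket k4 n1 = 1" "bracket k4 n2 = d" "bracket k4 n3 = - d'" "bracket k4 t = E234"
      "bracket n1 n2 = 1" "bracket n1 n3 = - 1" "bracket n1 t = \<delta>" "bracket n2 n3 = 1" "bracket n2 t = c * b'"
    by (simp_all add: bracket_def vecs E succ \<delta>_def algebra_simps)
  \<comment> \<open>each identity says that the third product of two brackets in a Pluecker relation is a monomial\<close>
  have complements: "b - b' = - 1"
      "(- d) - 1 = - d'"
      "E124 - E123 = E134"
      "(b * E134) - (a * E234) = d' * E123"
      "(b' * E134) - (a' * E234) = c' * E124"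
      "(b' * c * d') - (b * c' * d) = - E234"
      "(a' * d') - (a * c') = E134"
      "(a' * d) - (- b') = E124"
      "(- (a * c)) - b = - E123"
      "(d' * \<delta>) - E234 = b * c'"
      "(d * \<delta>) - E234 = c * b'"
      "b' - \<delta> = c'"
    by (simp_all add: E succ \<delta>_def algebra_simps)
  \<comment> \<open>the symbols of the tetrahedron\<close>
  have m1: "B (a / a') = cross_symbol l e2 e3 e4"
  proof -
    have eq: "bracket l e3 * bracket e2 e4 / (bracket l e4 * bracket e2 e3) = a / a'"
      unfolding br complements using nz Enz by (simp add: divide_simps)
    show ?thesis unfolding cross_symbol_def eq by (rule refl)
  qed
  have m2: "B (b' / b) = cross_symbol e2 e3 e4 r"
  proof -
    have eq: "bracket e2 e4 * bracket e3 r / (bracket e2 r * bracket e3 e4) = b / (b - b')"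
      unfolding br complements using nz Enz by (simp add: divide_simps)
    show ?thesis unfolding cross_symbol_def eq by (simp only: B_inverse_complement minus_minus)
  qed
  have m3: "B ((- 1) / c) = - cross_symbol e2 e3 s23 r"
  proof -
    have eq: "bracket e2 s23 * bracket e3 r / (bracket e2 r * bracket e3 s23) = c / (- 1)"
      unfolding br complements using nz Enz by (simp add: divide_simps)
    show ?thesis unfolding cross_symbol_def eq by (rule B_divide_swap)
  qed
  have m4: "B ((- d) / 1) = - cross_symbol k4 n1 n2 n3"
  proof -
    have eq: "bracket k4 n2 * bracket n1 n3 / (bracket k4 n3 * bracket n1 n2) = (- d) / ((- d) - 1)"
      unfolding br complements using nz Enz by (simp add: divide_simps)
    show ?thesis unfolding cross_symbol_def eq by (simp only: B_reflected minus_minus)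
  qed
  \<comment> \<open>The symbols of the dual.  On \<open>l\<^sub>2\<close> the projection from \<open>x\<^sub>1\<close> sees \<open>p\<^sub>1\<^sub>2\<close> as \<open>l\<^sub>1\<close>, so that the dual
    coordinate at the vertex 2, the cross-ratio of \<open>x\<^sub>2, p\<^sub>1\<^sub>2, p\<^sub>2\<^sub>3, p\<^sub>2\<^sub>4\<close>, appears in the pencil at \<open>x\<^sub>1\<close>;
    likewise for \<open>l\<^sub>3\<close> and \<open>l\<^sub>4\<close>.\<close>
  have m5: "B (E124 / E123) = - cross_symbol l s23 s24 s34"
  proof -
    have eq: "bracket l s24 * bracket s23 s34 / (bracket l s34 * bracket s23 s24) = E124 / (E124 - E123)"
      unfolding br complements using nz Enz by (simp add: divide_simps)
    show ?thesis unfolding cross_symbol_def eq by (simp only: B_reflected minus_minus)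
  qed
  have m6: "B ((d * E123) / (c * E124)) = cross_symbol l e2 s23 s24"
  proof -
    have eq: "bracket l s23 * bracket e2 s24 / (bracket l s24 * bracket e2 s23) = (d * E123) / (c * E124)"
      unfolding br complements using nz Enz by (simp add: divide_simps)
    show ?thesis unfolding cross_symbol_def eq by (rule refl)
  qed
  have m7: "B ((a * E234) / (b * E134)) = - cross_symbol l e3 s23 s34"
  proof -
    have eq: "bracket l s23 * bracket e3 s34 / (bracket l s34 * bracket e3 s23) = ((b * E134) - (a * E234)) / (b * E134)"
      unfolding br complements using nz Enz by (simp add: divide_simps)
    show ?thesis unfolding cross_symbol_def eq by (simp only: B_quotient_complement minus_minus)
  qed
  have m8: "B ((b' * E134) / (a' * E234)) = cross_symbol l e4 s24 s34"
  proof -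
    have eq: "bracket l s24 * bracket e4 s34 / (bracket l s34 * bracket e4 s24) = ((b' * E134) - (a' * E234)) / (b' * E134)"
      unfolding br complements using nz Enz by (simp add: divide_simps)
    show ?thesis unfolding cross_symbol_def eq by (simp only: B_numerator_complement minus_minus)
  qed
  \<comment> \<open>The symbols of the faces: minus the triple ratio of three flags \<open>i, j, k\<close> is a cross-ratio of
    the lines through \<open>x\<^sub>i\<close> given by \<open>l\<^sub>i, x\<^sub>j, x\<^sub>k, p\<^sub>j\<^sub>k\<close>.\<close>
  have m9: "B ((b * c' * d) / (b' * c * d')) = cross_symbol k4 n2 n3 t"
  proof -
    have eq: "bracket k4 n3 * bracket n2 t / (bracket k4 t * bracket n2 n3) = (b' * c * d') / ((b' * c * d') - (b * c' * d))"
      unfolding br complements using nz Enz by (simp add: divide_simps)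
    show ?thesis unfolding cross_symbol_def eq by (simp only: B_inverse_complement minus_minus)
  qed
  have m10: "B ((a' * d') / (a * c')) = - cross_symbol l e3 e4 s34"
  proof -
    have eq: "bracket l e4 * bracket e3 s34 / (bracket l s34 * bracket e3 e4) = (a' * d') / ((a' * d') - (a * c'))"
      unfolding br complements using nz Enz by (simp add: divide_simps)
    show ?thesis unfolding cross_symbol_def eq by (simp only: B_reflected minus_minus)
  qed
  have m11: "B ((- b') / (a' * d)) = cross_symbol l e2 e4 s24"
  proof -
    have eq: "bracket l e4 * bracket e2 s24 / (bracket l s24 * bracket e2 e4) = (a' * d) / ((a' * d) - (- b'))"
      unfolding br complements using nz Enz by (simp add: divide_simps)
    show ?thesis unfolding cross_symbol_def eq by (simp only: B_inverse_complement minus_minus)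
  qed
  have m12: "B ((- (a * c)) / b) = - cross_symbol l e2 e3 s23"
  proof -
    have eq: "bracket l e3 * bracket e2 s23 / (bracket l s23 * bracket e2 e3) = (- (a * c)) / ((- (a * c)) - b)"
      unfolding br complements using nz Enz by (simp add: divide_simps)
    show ?thesis unfolding cross_symbol_def eq by (simp only: B_reflected minus_minus)
  qed
  \<comment> \<open>Coincidences between pencils: \<open>p1\<close> compares the projections from \<open>x\<^sub>1\<close> and \<open>x\<^sub>4\<close> of four points of \<open>l\<^sub>3\<close>,
    \<open>p2\<close> and \<open>p4\<close> those of four points of \<open>l\<^sub>2\<close>; \<open>p3\<close> is a coincidence inside the pencil at \<open>x\<^sub>1\<close>.\<close>
  have p1: "cross_symbol e3 e4 s23 s34 = cross_symbol k4 n1 n3 t"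
  proof -
    have eq: "bracket e3 s23 * bracket e4 s34 / (bracket e3 s34 * bracket e4 s23) = ((d' * \<delta>) - E234) / (d' * \<delta>)"
      unfolding br complements using nz Enz by (simp add: divide_simps)
    have eq': "bracket k4 n3 * bracket n1 t / (bracket k4 t * bracket n1 n3) = (d' * \<delta>) / E234"
      unfolding br complements using nz Enz by (simp add: divide_simps)
    show ?thesis unfolding cross_symbol_def eq eq' by (rule B_numerator_complement)
  qed
  have p2: "cross_symbol e2 e4 s23 s24 = cross_symbol k4 n1 n2 t"
  proof -
    have eq: "bracket e2 s23 * bracket e4 s24 / (bracket e2 s24 * bracket e4 s23) = ((d * \<delta>) - E234) / (d * \<delta>)"
      unfolding br complements using nz Enz by (simp add: divide_simps)
    have eq': "bracket k4 n2 * bracket n1 t / (bracket k4 t * bracket n1 n2) = (d * \<delta>) / E234"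
      unfolding br complements using nz Enz by (simp add: divide_simps)
    show ?thesis unfolding cross_symbol_def eq eq' by (rule B_numerator_complement)
  qed
  have p3: "cross_symbol e4 s23 s24 s34 = - cross_symbol e3 e4 s23 r"
  proof -
    have eq: "bracket e4 s24 * bracket s23 s34 / (bracket e4 s34 * bracket s23 s24) = b' / (b' - \<delta>)"
      unfolding br complements using nz Enz by (simp add: divide_simps)
    have eq': "bracket e3 s23 * bracket e4 r / (bracket e3 r * bracket e4 s23) = b' / \<delta>"
      unfolding br complements using nz Enz by (simp add: divide_simps)
    show ?thesis unfolding cross_symbol_def eq eq' by (rule B_reflected)
  qed
  have p4: "cross_symbol e2 e4 s23 r = cross_symbol n1 n2 n3 t"
  proof -
    have eq: "bracket e2 s23 * bracket e4 r / (bracket e2 r * bracket e4 s23) = (c * b') / (- \<delta>)"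
      unfolding br complements using nz Enz by (simp add: divide_simps)
    have eq': "bracket n1 n3 * bracket n2 t / (bracket n1 t * bracket n2 n3) = (c * b') / (- \<delta>)"
      unfolding br complements using nz Enz by (simp add: divide_simps)
    show ?thesis unfolding cross_symbol_def eq eq' by (rule refl)
  qed
  have "five_point_sum l e3 e4 s23 s34 - five_point_sum l e2 e4 s23 s24 + five_point_sum l e2 e3 e4 s23
      - five_point_sum l e4 s23 s24 s34 - five_point_sum e2 e3 e4 s23 r - five_point_sum k4 n1 n2 n3 t = 0"
    using vnz by (simp add: five_point_relation)
  then show ?thesis
    unfolding five_point_sum_def m1 m2 m3 m4 m5 m6 m7 m8 m9 m10 m11 m12 p1 p2 p3 p4
    by (simp add: algebra_simps)
qed

end


section \<open>Normal form of a very generic tetrahedron\<close>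

lemma det3_mult_det3:
  "det3 f g h * det3 x y z =
     scalar_product f x * (scalar_product g y * scalar_product h z - scalar_product g z * scalar_product h y)
   - scalar_product f y * (scalar_product g x * scalar_product h z - scalar_product g z * scalar_product h x)
   + scalar_product f z * (scalar_product g x * scalar_product h y - scalar_product g y * scalar_product h x)"
  by (simp add: det_3 scalar_product_def sum_3 algebra_simps)

lemma cramer_det3:
  "det3 x y z *s w = det3 w y z *s x + det3 x w z *s y + det3 x y w *s (z :: complex^3)"
  by (simp add: vec_eq_iff forall_3 det_3 algebra_simps)

lemma scalar_product_add: "scalar_product f (x + y) = scalar_product f x + scalar_product f y" for f :: "complex^3"
  by (simp add: scalar_product_def sum_3 algebra_simps)

text \<open>
  Up to a linear change of coordinates this puts the four points at the standard projective frame and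
  leaves the four parameters \<open>a, b, c, d\<close> of the functionals.  The coordinates \<open>z\<^sub>i\<^sub>j\<close> involve determinants only in
  quotients of degree 0, so that it is enough to rescale representatives, without moving the points
  \<open>x\<^sub>1, x\<^sub>2, x\<^sub>3\<close> to a basis.
\<close>

definition normalised_tetra :: "tetra \<Rightarrow> bool" where
  "normalised_tetra T \<longleftrightarrow> fst (T 4) = fst (T 1) + fst (T 2) + fst (T 3) \<and>
     scalar_product (snd (T 1)) (fst (T 2)) = 1 \<and> scalar_product (snd (T 2)) (fst (T 1)) = 1 \<and>
     scalar_product (snd (T 3)) (fst (T 1)) = 1 \<and> scalar_product (snd (T 4)) (fst (T 1)) = 1"

definition rescale :: "(nat \<Rightarrow> complex) \<Rightarrow> (nat \<Rightarrow> complex) \<Rightarrow> tetra \<Rightarrow> tetra" where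
  "rescale p q T = (\<lambda>m. (p m *s fst (T m), q m *s snd (T m)))"

lemma very_generic_tetra_nonzero:
  assumes "very_generic_tetra T" "i \<in> verts" "j \<in> verts" "k \<in> verts" "distinct [i, j, k]"
  shows "scalar_product (snd (T i)) (fst (T j)) \<noteq> 0" "scalar_product (snd (T i)) (fst (T i)) = 0"
    "det3 (fst (T i)) (fst (T j)) (fst (T k)) \<noteq> 0" "det3 (snd (T i)) (snd (T j)) (snd (T k)) \<noteq> 0"
  using assms unfolding very_generic_tetra_def generic_tetra_def is_flag_def
    collinear_points_iff_det concurrent_lines_iff_det by auto

lemma very_generic_tetra_rescale:
  assumes "very_generic_tetra T" "\<And>m. p m \<noteq> 0" "\<And>m. q m \<noteq> 0"
  shows "very_generic_tetra (rescale p q T)"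
  using assms
  unfolding very_generic_tetra_def generic_tetra_def is_flag_def rescale_def
    collinear_points_iff_det concurrent_lines_iff_det
  by (simp add: det3_scale scalar_product_scale)

lemma rescale_coordinates:
  assumes "\<And>m. p m \<noteq> 0" "\<And>m. q m \<noteq> 0" "i \<in> verts" "j \<in> verts" "i \<noteq> j"
  shows "zcoord (rescale p q T) i j = zcoord T i j"
    "zcoord (dual_tetra (rescale p q T)) i j = zcoord (dual_tetra T) i j"
  using zcoord_rescale[of p q i j T] zcoord_rescale[of q p i j "dual_tetra T"] assms
  by (simp_all add: rescale_def dual_tetra_def dual_flag_def)

lemma rescale_ztriple:
  assumes "\<And>m. p m \<noteq> 0" "\<And>m. q m \<noteq> 0" "i \<in> verts" "j \<in> verts" "k \<in> verts"
  shows "ztriple (rescale p q T) i j k = ztriple T i j k"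
  using ztriple_rescale[of p q i j k T] assms by (simp add: rescale_def)

lemma normalised_rescaling:
  assumes T: "very_generic_tetra T"
  obtains p q where "\<And>m. p m \<noteq> 0" "\<And>m. q m \<noteq> 0" "normalised_tetra (rescale p q T)"
proof -
  define x where "x m = fst (T m)" for m
  define f where "f m = snd (T m)" for m
  note [simp del] = One_nat_def
  \<comment> \<open>the coordinates of \<open>x\<^sub>4\<close> in the basis \<open>x\<^sub>1, x\<^sub>2, x\<^sub>3\<close>, by Cramer's rule\<close>
  define p :: "nat \<Rightarrow> complex" where
    "p = (\<lambda>_. 1)(1 := det3 (x 4) (x 2) (x 3) / det3 (x 1) (x 2) (x 3),
               2 := det3 (x 1) (x 4) (x 3) / det3 (x 1) (x 2) (x 3),
               3 := det3 (x 1) (x 2) (x 4) / det3 (x 1) (x 2) (x 3))"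
  define q :: "nat \<Rightarrow> complex" where
    "q = (\<lambda>m. 1 / (p 1 * scalar_product (f m) (x 1)))(1 := 1 / (p 2 * scalar_product (f 1) (x 2)))"
  define q' where "q' = (\<lambda>m. if m \<in> verts then q m else 1)"
  note nz = very_generic_tetra_nonzero[OF T]
  have d: "det3 (x 1) (x 2) (x 3) \<noteq> 0" "det3 (x 4) (x 2) (x 3) \<noteq> 0" "det3 (x 1) (x 4) (x 3) \<noteq> 0"
      "det3 (x 1) (x 2) (x 4) \<noteq> 0"
    unfolding x_def by (intro nz; simp)+
  have s: "scalar_product (f 1) (x 2) \<noteq> 0" "scalar_product (f 2) (x 1) \<noteq> 0"
      "scalar_product (f 3) (x 1) \<noteq> 0" "scalar_product (f 4) (x 1) \<noteq> 0"
    unfolding x_def f_def using nz(1)[of 1 2 3] nz(1)[of 2 1 3] nz(1)[of 3 1 2] nz(1)[of 4 1 2] by simp_all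
  have p: "p m \<noteq> 0" for m
    using d by (simp add: p_def)
  have q: "q' m \<noteq> 0" for m
    using s p[of 1] p[of 2] by (auto simp: q'_def q_def)
  have "x 4 = (1 / det3 (x 1) (x 2) (x 3)) *s (det3 (x 1) (x 2) (x 3) *s x 4)"
    using d(1) by (simp add: vector_smult_assoc)
  also have "\<dots> = p 1 *s x 1 + p 2 *s x 2 + p 3 *s x 3"
    unfolding cramer_det3[of "x 1" "x 2" "x 3" "x 4"]
    by (simp add: p_def vector_smult_assoc vector_add_ldistrib)
  finally have "x 4 = p 1 *s x 1 + p 2 *s x 2 + p 3 *s x 3" .
  moreover have "p 4 = 1" by (simp add: p_def)
  ultimately have "normalised_tetra (rescale p q' T)"
    using s p[of 1] p[of 2]
    unfolding normalised_tetra_def rescale_def fst_conv snd_conv scalar_product_scale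
    by (simp add: q'_def q_def x_def f_def)
  with p q show ?thesis by (rule that)
qed

lemma normalised_coordinates:
  fixes T :: tetra
  defines "a \<equiv> scalar_product (snd (T 1)) (fst (T 3))" and "b \<equiv> scalar_product (snd (T 2)) (fst (T 3))"
    and "c \<equiv> scalar_product (snd (T 3)) (fst (T 2))" and "d \<equiv> scalar_product (snd (T 4)) (fst (T 2))"
  defines "e123 \<equiv> b + a * c" and "e124 \<equiv> 1 + b + d * (1 + a)" and "e134 \<equiv> 1 + d + a * d - a * c"
    and "e234 \<equiv> b * d - c * (1 + b) - c * d"
  assumes vg: "very_generic_tetra T" and norm: "normalised_tetra T"
  shows "a \<noteq> 0" "b \<noteq> 0" "c \<noteq> 0" "d \<noteq> 0" "1 + a \<noteq> 0" "1 + b \<noteq> 0" "1 + c \<noteq> 0" "1 + d \<noteq> 0"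
    and "e123 \<noteq> 0" "e124 \<noteq> 0" "e134 \<noteq> 0" "e234 \<noteq> 0"
    and "zcoord T 1 2 = a / (1 + a)" "zcoord T 2 1 = (1 + b) / b"
      "zcoord T 3 4 = - 1 / c" "zcoord T 4 3 = - d / 1"
    and "zcoord (dual_tetra T) 1 2 = e124 / e123" "zcoord (dual_tetra T) 2 1 = (d * e123) / (c * e124)"
      "zcoord (dual_tetra T) 3 4 = (a * e234) / (b * e134)"
      "zcoord (dual_tetra T) 4 3 = ((1 + b) * e134) / ((1 + a) * e234)"
    and "- ztriple T 2 3 4 = (b * (1 + c) * d) / ((1 + b) * c * (1 + d))"
      "- ztriple T 1 4 3 = ((1 + a) * (1 + d)) / (a * (1 + c))"
      "- ztriple T 1 2 4 = - (1 + b) / ((1 + a) * d)"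
      "- ztriple T 1 3 2 = - (a * c) / b"
proof -
  define x where "x m = fst (T m)" for m
  define f where "f m = snd (T m)" for m
  note [simp del] = One_nat_def
  note nz = very_generic_tetra_nonzero[OF vg, folded x_def f_def]
  define \<Delta> where "\<Delta> = det3 (x 1) (x 2) (x 3)"
  have x4: "x 4 = x 1 + x 2 + x 3"
    and unit: "scalar_product (f 1) (x 2) = 1" "scalar_product (f 2) (x 1) = 1"
      "scalar_product (f 3) (x 1) = 1" "scalar_product (f 4) (x 1) = 1"
    using norm unfolding normalised_tetra_def x_def f_def by auto
  have self: "scalar_product (f 1) (x 1) = 0" "scalar_product (f 2) (x 2) = 0"
      "scalar_product (f 3) (x 3) = 0" "scalar_product (f 4) (x 4) = 0"
    using nz(2)[of 1 2 3] nz(2)[of 2 1 3] nz(2)[of 3 1 2] nz(2)[of 4 1 2] by simp_all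
  have par: "scalar_product (f 1) (x 3) = a" "scalar_product (f 2) (x 3) = b"
      "scalar_product (f 3) (x 2) = c" "scalar_product (f 4) (x 2) = d"
    by (simp_all add: a_def b_def c_def d_def x_def f_def)
  have to4: "scalar_product (f 1) (x 4) = 1 + a" "scalar_product (f 2) (x 4) = 1 + b"
      "scalar_product (f 3) (x 4) = 1 + c" "scalar_product (f 4) (x 3) = - (1 + d)"
    using self(4) unfolding x4 scalar_product_add self unit par by (simp_all add: add_eq_0_iff algebra_simps)
  note vals = self unit par to4
  have \<Delta>: "\<Delta> \<noteq> 0" unfolding \<Delta>_def by (intro nz; simp)
  show "a \<noteq> 0" "b \<noteq> 0" "c \<noteq> 0" "d \<noteq> 0" "1 + a \<noteq> 0" "1 + b \<noteq> 0" "1 + c \<noteq> 0" "1 + d \<noteq> 0"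
    using nz(1)[of 1 3 2] nz(1)[of 2 3 1] nz(1)[of 3 2 1] nz(1)[of 4 2 1]
      nz(1)[of 1 4 2] nz(1)[of 2 4 1] nz(1)[of 3 4 1] nz(1)[of 4 3 1]
    by (simp_all add: vals neg_equal_0_iff_equal del: minus_add_distrib add_uminus_conv_diff)
  have dx: "det3 (x 1) (x 2) (x 4) = \<Delta>" "det3 (x 2) (x 1) (x 3) = - \<Delta>" "det3 (x 2) (x 1) (x 4) = - \<Delta>"
     "det3 (x 3) (x 4) (x 2) = \<Delta>" "det3 (x 3) (x 4) (x 1) = - \<Delta>"
     "det3 (x 4) (x 3) (x 1) = \<Delta>" "det3 (x 4) (x 3) (x 2) = - \<Delta>"
    unfolding x4 \<Delta>_def by (simp_all add: det_3 algebra_simps)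
  show "zcoord T 1 2 = a / (1 + a)" "zcoord T 2 1 = (1 + b) / b" "zcoord T 3 4 = - 1 / c" "zcoord T 4 3 = - d / 1"
    using \<Delta> unfolding zcoord_eq[OF even_orders(1)] zcoord_eq[OF even_orders(4)] zcoord_eq[OF even_orders(9)]
      zcoord_eq[OF even_orders(12)]
    by (simp_all add: vals dx \<Delta>_def[symmetric] x_def[symmetric] f_def[symmetric])
  \<comment> \<open>all determinants of functionals carry the same factor \<open>1 / \<Delta>\<close>, which the quotients lose\<close>
  have "det3 (f 1) (f 2) (f 3) * \<Delta> = e123" "det3 (f 1) (f 2) (f 4) * \<Delta> = e124"
     "det3 (f 1) (f 3) (f 4) * \<Delta> = e134" "det3 (f 2) (f 3) (f 4) * \<Delta> = e234"
    unfolding \<Delta>_def det3_mult_det3 vals e123_def e124_def e134_def e234_def by (simp_all add: algebra_simps)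
  then have df: "det3 (f 1) (f 2) (f 3) = e123 / \<Delta>" "det3 (f 1) (f 2) (f 4) = e124 / \<Delta>"
     "det3 (f 1) (f 3) (f 4) = e134 / \<Delta>" "det3 (f 2) (f 3) (f 4) = e234 / \<Delta>"
    using \<Delta> by (simp_all add: eq_divide_eq)
  have "det3 (f 1) (f 2) (f 3) \<noteq> 0" "det3 (f 1) (f 2) (f 4) \<noteq> 0" "det3 (f 1) (f 3) (f 4) \<noteq> 0"
     "det3 (f 2) (f 3) (f 4) \<noteq> 0"
    by (intro nz; simp)+
  then show e: "e123 \<noteq> 0" "e124 \<noteq> 0" "e134 \<noteq> 0" "e234 \<noteq> 0" unfolding df by auto
  have df': "det3 (f 2) (f 1) (f 3) = - e123 / \<Delta>" "det3 (f 2) (f 1) (f 4) = - e124 / \<Delta>"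
     "det3 (f 3) (f 4) (f 1) = e134 / \<Delta>" "det3 (f 3) (f 4) (f 2) = e234 / \<Delta>"
     "det3 (f 4) (f 3) (f 1) = - e134 / \<Delta>" "det3 (f 4) (f 3) (f 2) = - e234 / \<Delta>"
    by (simp_all add: df[symmetric] minus_divide_left[symmetric]) (simp_all add: det_3 algebra_simps)
  have dual: "fst (dual_tetra T m) = f m" "snd (dual_tetra T m) = x m" for m
    by (simp_all add: dual_tetra_def dual_flag_def x_def f_def)
  show "zcoord (dual_tetra T) 1 2 = e124 / e123" "zcoord (dual_tetra T) 2 1 = (d * e123) / (c * e124)"
      "zcoord (dual_tetra T) 3 4 = (a * e234) / (b * e134)"
      "zcoord (dual_tetra T) 4 3 = ((1 + b) * e134) / ((1 + a) * e234)"
    using \<Delta> e unfolding zcoord_eq[OF even_orders(1)] zcoord_eq[OF even_orders(4)] zcoord_eq[OF even_orders(9)]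
      zcoord_eq[OF even_orders(12)] dual scalar_product_commute[of "x _"] df df' vals by simp_all
  show "- ztriple T 2 3 4 = (b * (1 + c) * d) / ((1 + b) * c * (1 + d))"
      "- ztriple T 1 4 3 = ((1 + a) * (1 + d)) / (a * (1 + c))"
      "- ztriple T 1 2 4 = - (1 + b) / ((1 + a) * d)"
      "- ztriple T 1 3 2 = - (a * c) / b"
    unfolding ztriple_def Let_def x_def[symmetric] f_def[symmetric] vals
    by (simp_all del: minus_add_distrib add_uminus_conv_diff)
qed


section \<open>Duality of tetrahedra and of closed complexes\<close>

text \<open>
  One representative of the boundary orientation is chosen for each face; by cyclic invariance of the
  triple ratio every even order \<open>(l, i, j, k)\<close> gives the same value.
\<close>

definition face_ratio :: "tetra \<Rightarrow> nat \<Rightarrow> complex" where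
  "face_ratio T l =
     (if l = 1 then ztriple T 2 3 4 else if l = 2 then ztriple T 1 4 3
      else if l = 3 then ztriple T 1 2 4 else ztriple T 1 3 2)"

lemma ztriple_rotate: "ztriple T j k i = ztriple T i j k"
  by (simp add: ztriple_def mult_ac)

lemma ztriple_eq_face_ratio:
  assumes "even_order l i j k"
  shows "ztriple T i j k = face_ratio T l"
proof -
  have rot: "ztriple T 3 4 2 = ztriple T 2 3 4" "ztriple T 4 2 3 = ztriple T 2 3 4"
      "ztriple T 4 3 1 = ztriple T 1 4 3" "ztriple T 3 1 4 = ztriple T 1 4 3"
      "ztriple T 2 4 1 = ztriple T 1 2 4" "ztriple T 4 1 2 = ztriple T 1 2 4"
      "ztriple T 3 2 1 = ztriple T 1 3 2" "ztriple T 2 1 3 = ztriple T 1 3 2"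
    using ztriple_rotate[of T] by metis+
  have jk: "(j, k) = (j', k')" if "even_order l' i' j' k'" "l = l'" "i = i'" for l' i' j' k'
    using even_order_unique[OF assms] that by simp
  have "l \<in> verts" "i \<in> verts" "l \<noteq> i"
    using even_order_verts[OF assms] by auto
  then show ?thesis
    by (elim insertE emptyE; simp add: even_orders[THEN jk, simplified prod.inject] face_ratio_def rot del: One_nat_def)
qed

lemma even_order_odd_image:
  assumes "even_order l i j k" and \<sigma>: "\<sigma> permutes verts" "\<not> evenperm \<sigma>"
  shows "even_order (\<sigma> l) (\<sigma> i) (\<sigma> k) (\<sigma> j)"
proof -
  obtain \<tau> where \<tau>: "\<tau> permutes verts" "evenperm \<tau>" "\<tau> 1 = l" "\<tau> 2 = i" "\<tau> 3 = j" "\<tau> 4 = k"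
    using assms(1) unfolding even_order_def by blast
  let ?t = "Transposition.transpose 3 (4 :: nat)"
  have t: "?t permutes verts" by (intro permutes_swap_id) auto
  have "permutation \<sigma>" "permutation \<tau>" "permutation ?t" "permutation (\<tau> \<circ> ?t)"
    using \<sigma>(1) \<tau>(1) t permutes_compose[OF t \<tau>(1)] by (auto intro: permutes_imp_permutation[rotated])
  then have "evenperm (\<sigma> \<circ> (\<tau> \<circ> ?t))"
    using \<sigma>(2) \<tau>(2) by (simp add: evenperm_comp evenperm_swap)
  moreover have "\<sigma> \<circ> (\<tau> \<circ> ?t) permutes verts"
    by (intro permutes_compose t \<tau>(1) \<sigma>(1))
  ultimately show ?thesis
    unfolding even_order_def
    by (intro exI[of _ "\<sigma> \<circ> (\<tau> \<circ> ?t)"]) (simp add: \<tau> Transposition.transpose_def del: One_nat_def)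
qed

text \<open>
  The terms cancel in pairs.  Reindexing by the involution would only show that twice the sum
  vanishes, which is weaker in a group with 2-torsion.
\<close>

lemma sum_fixpoint_free_involution:
  fixes g :: "'b \<Rightarrow> 'c::ab_group_add"
  assumes "finite S" and "\<And>x. x \<in> S \<Longrightarrow> \<iota> x \<in> S \<and> \<iota> x \<noteq> x \<and> \<iota> (\<iota> x) = x \<and> g (\<iota> x) = - g x"
  shows "sum g S = 0"
  using assms
proof (induction S rule: finite_psubset_induct)
  case (psubset S)
  show ?case
  proof (cases "S = {}")
    case False
    then obtain x where x: "x \<in> S" by auto
    note inv = psubset.prems
    let ?R = "S - {x} - {\<iota> x}"
    have "sum g ?R = 0"
    proof (rule psubset.IH)
      show "?R \<subset> S" using x by auto
      fix y assume y: "y \<in> ?R"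
      then have "\<iota> y \<noteq> x" "\<iota> y \<noteq> \<iota> x"
        using inv[OF x] inv[of y] by (metis DiffE insertCI)+
      with y show "\<iota> y \<in> ?R \<and> \<iota> y \<noteq> y \<and> \<iota> (\<iota> y) = y \<and> g (\<iota> y) = - g y"
        using inv[of y] by auto
    qed
    moreover have "sum g S = g x + (g (\<iota> x) + sum g ?R)"
      using psubset.hyps x inv[OF x] by (simp add: sum.remove[of S x] sum.remove[of "S - {x}" "\<iota> x"])
    ultimately show ?thesis using inv[OF x] by simp
  qed simp
qed

context five_term_function
begin

definition tetra_symbol :: "tetra \<Rightarrow> 'a" where
  "tetra_symbol T = B (zcoord T 1 2) + B (zcoord T 2 1) + B (zcoord T 3 4) + B (zcoord T 4 3)"

text \<open>
  Duality changes the symbol of a tetrahedron by a term for each face, and that term depends only on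
  the three flags of the face.  Both sides are unchanged by rescaling, which reduces this to the
  identity in four parameters.
\<close>

theorem tetra_symbol_dual:
  assumes T: "very_generic_tetra T"
  shows "tetra_symbol T - tetra_symbol (dual_tetra T) + (\<Sum>l\<in>verts. B (- face_ratio T l)) = 0"
proof -
  obtain p q where p: "\<And>m. p m \<noteq> 0" and q: "\<And>m. q m \<noteq> 0"
    and norm: "normalised_tetra (rescale p q T)"
    using normalised_rescaling[OF T] by metis
  let ?T = "rescale p q T"
  note co = normalised_coordinates[OF very_generic_tetra_rescale[OF T p q] norm]
  have z: "tetra_symbol T = tetra_symbol ?T" "tetra_symbol (dual_tetra T) = tetra_symbol (dual_tetra ?T)"
    by (simp_all add: tetra_symbol_def rescale_coordinates[OF p q] del: One_nat_def)
  have sum: "(\<Sum>l\<in>verts. B (- face_ratio T l)) = B (- ztriple ?T 2 3 4) + B (- ztriple ?T 1 4 3)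
      + B (- ztriple ?T 1 2 4) + B (- ztriple ?T 1 3 2)"
    by (simp add: face_ratio_def rescale_ztriple[OF p q] add.assoc del: One_nat_def)
  show ?thesis
    unfolding z sum
    unfolding tetra_symbol_def co(13-24)
    by (rule duality_identity[OF co(1-8) refl refl refl refl co(9-12) refl refl refl refl])
qed

text \<open>
  The face equation makes the face terms of two glued faces opposite, as \<open>B (1 / x) = - B x\<close>.
\<close>

lemma glued_face_symbols:
  assumes K: "ideal_triangulation K" and F: "face_equations K F"
    and \<nu>: "\<nu> \<in> {1..num_tets K}" and l: "l \<in> verts" and g: "gluing K \<nu> l = Some (\<mu>, \<sigma>)"
  shows "B (- face_ratio (F \<mu>) (\<sigma> l)) = - B (- face_ratio (F \<nu>) l)"
proof -
  have \<sigma>: "\<sigma> permutes verts" "\<not> evenperm \<sigma>"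
    using K \<nu> l g unfolding ideal_triangulation_def by blast+
  define i where "i = (if l = 1 then 2 else 1 :: nat)"
  have i: "i \<in> verts" "l \<noteq> i" by (simp_all add: i_def)
  obtain j k where ord: "even_order l i j k"
    using even_order_exists[OF l i] .
  have "ztriple (F \<nu>) i j k * ztriple (F \<mu>) (\<sigma> i) (\<sigma> k) (\<sigma> j) = 1"
    using F \<nu> ord g unfolding face_equations_def by blast
  then have "face_ratio (F \<nu>) l * face_ratio (F \<mu>) (\<sigma> l) = 1"
    by (simp add: ztriple_eq_face_ratio[OF ord] ztriple_eq_face_ratio[OF even_order_odd_image[OF ord \<sigma>]])
  then have "- face_ratio (F \<mu>) (\<sigma> l) = inverse (- face_ratio (F \<nu>) l)"
    by (metis inverse_minus_eq inverse_unique)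
  then show ?thesis by (simp only: B_inverse)
qed

theorem sum_tetra_symbol_dual:
  assumes K: "ideal_triangulation K" and closed: "no_free_faces K" and F: "face_equations K F"
    and vg: "very_generic_decoration K F"
  shows "(\<Sum>\<nu>\<in>{1..num_tets K}. tetra_symbol (F \<nu>)) =
    (\<Sum>\<nu>\<in>{1..num_tets K}. tetra_symbol (dual_decoration F \<nu>))"
proof -
  let ?N = "{1..num_tets K}"
  define \<iota> where "\<iota> = (\<lambda>(\<nu>, l). let (\<mu>, \<sigma>) = the (gluing K \<nu> l) in (\<mu>, \<sigma> l))"
  define g where "g = (\<lambda>(\<nu>, l). B (- face_ratio (F \<nu>) l))"
  have "sum g (?N \<times> verts) = 0"
  proof (rule sum_fixpoint_free_involution[where \<iota> = \<iota>])
    fix y assume "y \<in> ?N \<times> verts"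
    then obtain \<nu> l where y: "y = (\<nu>, l)" and \<nu>: "\<nu> \<in> ?N" and l: "l \<in> verts" by blast
    obtain \<mu> \<sigma> where gl: "gluing K \<nu> l = Some (\<mu>, \<sigma>)"
      using closed \<nu> l unfolding no_free_faces_def by fastforce
    have *: "\<mu> \<in> ?N" "\<sigma> permutes verts" "(\<mu>, \<sigma> l) \<noteq> (\<nu>, l)"
        "gluing K \<mu> (\<sigma> l) = Some (\<nu>, inv_into UNIV \<sigma>)"
      using K \<nu> l gl unfolding ideal_triangulation_def by blast+
    have \<iota>y: "\<iota> y = (\<mu>, \<sigma> l)" by (simp add: y \<iota>_def gl)
    have "\<sigma> l \<in> verts" using permutes_in_image[OF *(2)] l by blast
    moreover have "\<iota> (\<iota> y) = y"
      using permutes_inverses(2)[OF *(2)] by (simp add: \<iota>y) (simp add: y \<iota>_def *(4))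
    moreover have "g (\<iota> y) = - g y"
      unfolding \<iota>y unfolding g_def y using glued_face_symbols[OF K F \<nu> l gl] by simp
    ultimately show "\<iota> y \<in> ?N \<times> verts \<and> \<iota> y \<noteq> y \<and> \<iota> (\<iota> y) = y \<and> g (\<iota> y) = - g y"
      using *(1,3) \<iota>y y by simp
  qed simp
  then have faces: "(\<Sum>\<nu>\<in>?N. \<Sum>l\<in>verts. B (- face_ratio (F \<nu>) l)) = 0"
    unfolding g_def sum.cartesian_product .
  have "(\<Sum>\<nu>\<in>?N. tetra_symbol (F \<nu>) - tetra_symbol (dual_decoration F \<nu>)
      + (\<Sum>l\<in>verts. B (- face_ratio (F \<nu>) l))) = 0"
    using vg unfolding very_generic_decoration_def dual_decoration_def
    by (intro sum.neutral ballI tetra_symbol_dual) blast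
  then show ?thesis
    unfolding sum.distrib sum_subtractf faces by simp
qed

end


section \<open>The pre-Bloch group as an additive type\<close>

lemma five_term_in_carrier:
  assumes x: "x \<notin> {0, 1}" and y: "y \<notin> {0, 1}" and xy: "x \<noteq> y"
  shows "five_term x y \<in> carrier free_symbols"
proof -
  have a: "y / x \<notin> {0, 1}" using assms by auto
  have b: "(1 - inverse x) / (1 - inverse y) \<notin> {0, 1}" "(1 - x) / (1 - y) \<notin> {0, 1}"
    using assms by auto
  show ?thesis
    unfolding five_term_def carrier_free_Abelian_group_iff
    by (intro order.trans[OF keys_add] order.trans[OF keys_diff] Un_least) (use assms a b in auto)
qed

lemma subgroup_five_term: "subgroup five_term_subgroup free_symbols"
  unfolding five_term_subgroup_def
proof (rule group.generate_is_subgroup[OF group_free_Abelian_group])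
  show "{five_term x y | x y. x \<notin> {0, 1} \<and> y \<notin> {0, 1} \<and> x \<noteq> y} \<subseteq> carrier free_symbols"
    using five_term_in_carrier by blast
qed

lemma five_term_subgroup_closed:
  "0 \<in> five_term_subgroup"
  "\<lbrakk>c \<in> five_term_subgroup; d \<in> five_term_subgroup\<rbrakk> \<Longrightarrow> c + d \<in> five_term_subgroup"
  "c \<in> five_term_subgroup \<Longrightarrow> - c \<in> five_term_subgroup"
  using subgroup.one_closed[OF subgroup_five_term] subgroup.m_closed[OF subgroup_five_term, of c d]
    subgroup.m_inv_closed[OF subgroup_five_term, of c] subgroup.mem_carrier[OF subgroup_five_term, of c]
  by (auto simp: carrier_free_Abelian_group_iff)

lemma five_term_in_subgroup:
  "\<lbrakk>x \<notin> {0, 1}; y \<notin> {0, 1}; x \<noteq> y\<rbrakk> \<Longrightarrow> five_term x y \<in> five_term_subgroup"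
  unfolding five_term_subgroup_def by (intro generate.incl) blast

lemma pre_Bloch_class_eqI:
  assumes "c - d \<in> five_term_subgroup"
  shows "pre_Bloch_class c = pre_Bloch_class d"
proof -
  have "pre_Bloch_class d \<subseteq> pre_Bloch_class c" if "c - d \<in> five_term_subgroup" for c d
  proof
    fix x assume "x \<in> pre_Bloch_class d"
    then obtain h where "h \<in> five_term_subgroup" "x = h + d"
      by (auto simp: pre_Bloch_class_def r_coset_def)
    then have "h + - (c - d) \<in> five_term_subgroup" "x = (h + - (c - d)) + c"
      using that five_term_subgroup_closed(2,3) by (blast, simp)
    then show "x \<in> pre_Bloch_class c"
      unfolding pre_Bloch_class_def r_coset_def mult_free_Abelian_group by blast
  qed
  from this[of c d] this[of d c] assms show ?thesis
    using five_term_subgroup_closed(3)[OF assms] by simp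
qed

text \<open>
  The quotient of all formal sums, those with the symbols \<open>[0]\<close> and \<open>[1]\<close> included, by the subgroup of the
  five-term relations.  It contains the pre-Bloch group and is a type of class \<open>ab_group_add\<close>, so that
  the identities for functions into an abelian group apply to it.
\<close>

quotient_type five_term_quotient = "complex \<Rightarrow>\<^sub>0 int" / "\<lambda>c d. c - d \<in> five_term_subgroup"
proof (intro equivpI reflpI sympI transpI)
  fix b c d :: "complex \<Rightarrow>\<^sub>0 int"
  show "c - c \<in> five_term_subgroup" by (simp add: five_term_subgroup_closed)
  show "d - c \<in> five_term_subgroup" if "c - d \<in> five_term_subgroup"
    using five_term_subgroup_closed(3)[OF that] by simp
  show "b - d \<in> five_term_subgroup" if "b - c \<in> five_term_subgroup" "c - d \<in> five_term_subgroup"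
    using five_term_subgroup_closed(2)[OF that] by simp
qed

instantiation five_term_quotient :: ab_group_add
begin
lift_definition zero_five_term_quotient :: five_term_quotient is 0 .
lift_definition plus_five_term_quotient :: "five_term_quotient \<Rightarrow> five_term_quotient \<Rightarrow> five_term_quotient" is "(+)"
  by (simp only: add_diff_add five_term_subgroup_closed(2))
lift_definition uminus_five_term_quotient :: "five_term_quotient \<Rightarrow> five_term_quotient" is uminus
  subgoal for c d using five_term_subgroup_closed(3)[of "c - d"] by simp
  done
lift_definition minus_five_term_quotient :: "five_term_quotient \<Rightarrow> five_term_quotient \<Rightarrow> five_term_quotient" is "(-)"
  subgoal for a b c d
    using five_term_subgroup_closed(2)[of "a - b" "- (c - d)"] five_term_subgroup_closed(3)[of "c - d"]
    by (simp add: algebra_simps)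
  done
instance
  by standard (transfer; simp add: five_term_subgroup_closed algebra_simps)+
end

lift_definition bloch_symbol :: "complex \<Rightarrow> five_term_quotient"
  is "\<lambda>x. if x \<in> {0, 1} then 0 else frag_of x" .

lemma bloch_symbol_eq: "x \<notin> {0, 1} \<Longrightarrow> bloch_symbol x = abs_five_term_quotient (frag_of x)"
  by (simp add: bloch_symbol.abs_eq)

lemma bloch_symbol_five_term:
  assumes "x \<notin> {0, 1}" "y \<notin> {0, 1}" "x \<noteq> y"
  shows "bloch_symbol x - bloch_symbol y + bloch_symbol (y / x)
     - bloch_symbol ((1 - inverse x) / (1 - inverse y)) + bloch_symbol ((1 - x) / (1 - y)) = 0"
proof -
  have "y / x \<notin> {0, 1}" "(1 - inverse x) / (1 - inverse y) \<notin> {0, 1}" "(1 - x) / (1 - y) \<notin> {0, 1}"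
    using assms by auto
  note symbols = this[THEN bloch_symbol_eq] assms(1,2)[THEN bloch_symbol_eq]
  have "five_term x y - 0 \<in> five_term_subgroup"
    using five_term_in_subgroup[OF assms] by simp
  then show ?thesis
    unfolding symbols five_term_def
    by (simp only: plus_five_term_quotient.abs_eq minus_five_term_quotient.abs_eq
        zero_five_term_quotient_def five_term_quotient.abs_eq_iff)
qed

lemma abs_quotient_sum:
  "abs_five_term_quotient (\<Sum>\<nu>\<in>S. g \<nu>) = (\<Sum>\<nu>\<in>S. abs_five_term_quotient (g \<nu>))"
  by (induction S rule: infinite_finite_induct)
    (simp_all add: zero_five_term_quotient_def flip: plus_five_term_quotient.abs_eq)

interpretation bloch: five_term_function bloch_symbol
proof
  show "bloch_symbol 0 = 0" "bloch_symbol 1 = 0"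
    by (simp_all add: bloch_symbol.abs_eq zero_five_term_quotient_def)
qed (rule bloch_symbol_five_term)

lemma beta_eqI:
  assumes "generic_decoration K F" "generic_decoration K G"
    and eq: "(\<Sum>\<nu>\<in>{1..num_tets K}. bloch.tetra_symbol (F \<nu>)) = (\<Sum>\<nu>\<in>{1..num_tets K}. bloch.tetra_symbol (G \<nu>))"
  shows "beta K F = beta K G"
proof -
  let ?s = "\<lambda>H. \<Sum>\<nu>\<in>{1..num_tets K}. frag_of (zcoord (H \<nu>) 1 2) + frag_of (zcoord (H \<nu>) 2 1)
      + frag_of (zcoord (H \<nu>) 3 4) + frag_of (zcoord (H \<nu>) 4 3)"
  have "abs_five_term_quotient (?s H) = (\<Sum>\<nu>\<in>{1..num_tets K}. bloch.tetra_symbol (H \<nu>))"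
    if "generic_decoration K H" for H
    unfolding abs_quotient_sum
  proof (rule sum.cong[OF refl])
    fix \<nu> assume "\<nu> \<in> {1..num_tets K}"
    with that have "generic_tetra (H \<nu>)" unfolding generic_decoration_def by blast
    then have "zcoord (H \<nu>) i j \<notin> {0, 1}" if "i \<in> verts" "j \<in> verts" "i \<noteq> j" for i j
      using zcoord_not_0_1 that by blast
    then show "abs_five_term_quotient (frag_of (zcoord (H \<nu>) 1 2) + frag_of (zcoord (H \<nu>) 2 1)
        + frag_of (zcoord (H \<nu>) 3 4) + frag_of (zcoord (H \<nu>) 4 3)) = bloch.tetra_symbol (H \<nu>)"
      unfolding bloch.tetra_symbol_def
      by (simp add: bloch_symbol_eq plus_five_term_quotient.abs_eq del: One_nat_def)
  qed
  with assms have "abs_five_term_quotient (?s F) = abs_five_term_quotient (?s G)"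
    by simp
  then show ?thesis
    unfolding beta_def five_term_quotient.abs_eq_iff by (rule pre_Bloch_class_eqI)
qed

theorem theorem4p2:
  fixes K :: quasi_complex and F :: decoration
  assumes "ideal_triangulation K"
    and "no_free_faces K"
    and "F \<in> Sol K"
    and "very_generic_decoration K F"
  shows "beta K F = beta K (dual_decoration F) \<and>
         volume K F = volume K (dual_decoration F)"
proof -
  have "very_generic_decoration K (dual_decoration F)"
    using assms(4) very_generic_tetra_dual
    unfolding very_generic_decoration_def dual_decoration_def by blast
  then have "generic_decoration K F" "generic_decoration K (dual_decoration F)"
    using assms(4) unfolding very_generic_decoration_def generic_decoration_def very_generic_tetra_def
    by auto
  moreover have "face_equations K F" using assms(3) by (simp add: Sol_def)
  ultimately have "beta K F = beta K (dual_decoration F)"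
    using bloch.sum_tetra_symbol_dual[OF assms(1,2) _ assms(4)] by (intro beta_eqI)
  then show ?thesis by (simp add: volume_def)
qed

end
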